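(* Let $\Delta_\nu(x,u^{(n)})=0$, $1\le\nu\le l$, be a nondegenerate system of partial differential equations with $\Delta$ slowly increasing, and let $\eta\mapsto g_\eta$, $g_\eta\cdot(x,u)=(\Xi_\eta(x),\Phi_\eta(x,u))$, be a slowly increasing (hence projectable) one-parameter symmetry group of the system. Let $Q_{\mu\nu}$ ($1\le\mu,\nu\le l$) be smooth functions such that for all smooth $u$ for which $g_\eta u$ exists $$\Delta_\nu\big(\Xi_\eta(x),\mathrm{pr}^{(n)}(g_\eta u)(\Xi_\eta(x))\big)=\sum_{\mu=1}^l Q_{\mu\nu}(\eta,x,\mathrm{pr}^{(n)}u(x))\,\Delta_\mu(x,\mathrm{pr}^{(n)}u(x)),\qquad 1\le\nu\le l.$$ If $$P_{\mu\nu}:=\big(Q_{\mu\nu}(\eta,\Xi_{-\eta}(\cdot),\mathrm{pr}^{(n)}u_\varepsilon(\Xi_{-\eta}(\cdot)))\big)_{\varepsilon\in I}$$ belongs to $\mathcal E_M(\Xi_\eta(\Omega))$ for all $1\le\mu,\nu\le l$, every $\eta$ and every $(u_\varepsilon)_{\varepsilon\in I}\in\mathcal E_M(\Omega)^q$, then $\eta\mapsto g_\eta$ is a symmetry group of the system in $\mathcal G$ as well. This condition is satisfied if, for $1\le\mu,\nu\le l$ and every $\eta$, the map $(x,u^{(n)})\mapsto Q_{\mu\nu}(\eta,x,u^{(n)})$ is slowly increasing in the $u^{(n)}$-variables, uniformly for $x$ in compact sets.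
   Context: Jet notation: $x\in\mathcal X=\mathbb R^p$, $u\in\mathcal U=\mathbb R^q$; the group acts as a smooth local transformation group on an open set $\mathcal M\subseteq\mathcal X\times\mathcal U$; $\mathcal M^{(n)}$ is the $n$-jet space with coordinates $(x,u^{(n)})$; $\mathrm{pr}^{(n)}u(x)$ collects the values of $u$ and its partial derivatives up to order $n$ at $x$. The functions $Q_{\mu\nu}$ are defined on $(-\eta_o,\eta_o)\times\mathcal V$, with $\mathcal V$ open in $\mathcal M^{(n)}$. $g_\eta u$ is the function whose graph is the image under $g_\eta$ of the graph of $u$. The system is nondegenerate if $\Delta=(\Delta_1,\dots,\Delta_l)$ has rank $l$ at every point of $S_\Delta=\{\Delta=0\}$ and every point of $S_\Delta$ is the $n$-jet of some local smooth solution. A (classical) symmetry group transforms smooth solutions into smooth solutions whenever the transformed function is defined. Colombeau algebra: $I=(0,1]$, $\Omega\subseteq\mathbb R^p$ open. $\mathcal E_M(\Omega)$ is the set of $(u_\varepsilon)_{\varepsilon\in I}\in C^\infty(\Omega)^I$ such that for all compact $K\subset\Omega$ and all multi-indices $\alpha$ there is $m\in\mathbb N$ with $\sup_{x\in K}|\partial^\alpha u_\varepsilon(x)|=O(\varepsilon^{-m})$ as $\varepsilon\to0$; $\mathcal N(\Omega)$ is the set of those for which, for all $K,\alpha$ and all $m\in\mathbb N$, $\sup_{x\in K}|\partial^\alpha u_\varepsilon(x)|=O(\varepsilon^{m})$. $\mathcal G(\Omega)=\mathcal E_M(\Omega)/\mathcal N(\Omega)$; classes are written $\mathrm{cl}[(u_\varepsilon)_{\varepsilon\in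 I}]$. A smooth function is slowly increasing (in $\mathcal O_M$) if each of its partial derivatives is bounded by a constant times some power of $(1+|\cdot|)$. It is slowly increasing in some variables $w$, uniformly for $x$ in compact sets, if for every compact set of $x$ and every partial derivative there is $m$ such that the derivative is bounded by $C(1+|w|)^m$ for $x$ in that compact set. A projectable transformation $g$, $g\cdot(x,u)=(\Xi_g(x),\Phi_g(x,u))$, is slowly increasing if $u\mapsto\Phi_g(x,u)$ is slowly increasing, uniformly for $x$ in compact sets; slowly increasing group actions are always understood to be projectable. For such $g$ and $U=\mathrm{cl}[(u_\varepsilon)_\varepsilon]\in\mathcal G(\Omega)^q$, $gU:=\mathrm{cl}[((\Phi_g\circ(\mathrm{id}\times u_\varepsilon))\circ\Xi_g^{-1})_{\varepsilon\in I}]\in\mathcal G(\Xi_g(\Omega))^q$. A solution of the system in $\mathcal G$ is $U\in\mathcal G(\Omega)^q$ ($\Omega\subseteq\mathcal X$ open) satisfying the system with equality in $\mathcal G(\Omega)^l$. A local transformation group $G$ is a symmetry group of the system in $\mathcal G$ if, whenever $U$ is a solution in $\mathcal G$, $g\in G$ and $gU$ is defined, $gU$ is also a solution in $\mathcal G$. *)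

theory Defs
  imports "HOL-Analysis.Analysis" "HOL-Library.Type_Length"
begin

section \<open>Partial derivatives and smooth functions\<close>

text \<open>
  \<open>iter_partial [v\<^sub>1, \<dots>, v\<^sub>k] f\<close> differentiates \<open>f\<close> successively in the directions
  \<open>v\<^sub>1, \<dots>, v\<^sub>k\<close>.  When all directions are taken from \<^term>\<open>Basis\<close>, these are the
  iterated partial derivatives of \<open>f\<close>.
\<close>

primrec iter_partial ::
    "'a::real_normed_vector list \<Rightarrow> ('a \<Rightarrow> 'b::real_normed_vector) \<Rightarrow> 'a \<Rightarrow> 'b" where
  "iter_partial [] f = f"
| "iter_partial (v # vs) f = iter_partial vs (\<lambda>x. frechet_derivative f (at x) v)"

text \<open>
  Intended for open \<open>S\<close>.  Total differentiability of all iterated partial derivatives is the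
  same as their existence and continuity, that is, as \<open>f\<close> being of class \<open>C\<^sup>\<infinity>\<close> on \<open>S\<close>.
\<close>

definition smooth_on ::
    "'a::euclidean_space set \<Rightarrow> ('a \<Rightarrow> 'b::real_normed_vector) \<Rightarrow> bool" where
  "smooth_on S f \<longleftrightarrow>
     (\<forall>vs. set vs \<subseteq> Basis \<longrightarrow> (\<forall>x\<in>S. iter_partial vs f differentiable (at x)))"

definition slowly_increasing_on ::
    "'a::euclidean_space set \<Rightarrow> ('a \<Rightarrow> 'b::real_normed_vector) \<Rightarrow> bool" where
  "slowly_increasing_on S f \<longleftrightarrow> smooth_on S f \<and>
     (\<forall>vs. set vs \<subseteq> Basis \<longrightarrow>
       (\<exists>(C::real) (m::nat). \<forall>z\<in>S. norm (iter_partial vs f z) \<le> C * (1 + norm z) ^ m))"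

text \<open>
  Slow increase in the second variable, uniformly for the first one in compact sets.  The
  derivatives in question are those with respect to both variables.
\<close>

definition slowly_increasing_snd_on ::
    "('a::euclidean_space \<times> 'b::euclidean_space) set \<Rightarrow>
     ('a \<times> 'b \<Rightarrow> 'c::real_normed_vector) \<Rightarrow> bool" where
  "slowly_increasing_snd_on S f \<longleftrightarrow> smooth_on S f \<and>
     (\<forall>K vs. compact K \<and> K \<subseteq> fst ` S \<and> set vs \<subseteq> Basis \<longrightarrow>
       (\<exists>(C::real) (m::nat). \<forall>(x, w)\<in>S. x \<in> K \<longrightarrow>
          norm (iter_partial vs f (x, w)) \<le> C * (1 + norm w) ^ m))"

section \<open>Jet spaces\<close>

text \<open>
  The order \<open>n\<close> of the jets is the length of a type \<^typ>\<open>'n::len0\<close>, which can be any natural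
  number, including \<open>0\<close>.  The type \<open>('p, 'n) multi_index\<close> consists of the multi-indices in
  \<open>p\<close> variables of order at most \<open>n\<close>.
\<close>

typedef (overloaded) ('p::finite, 'n::len0) multi_index =
    "{\<alpha> :: 'p \<Rightarrow> nat. (\<Sum>i\<in>UNIV. \<alpha> i) \<le> LENGTH('n)}"
  morphisms exponents Multi_Index
  by (rule exI[of _ "\<lambda>_. 0"]) simp

instance multi_index :: (finite, len0) finite
proof
  have "{\<alpha> :: 'a \<Rightarrow> nat. (\<Sum>i\<in>UNIV. \<alpha> i) \<le> LENGTH('b)} \<subseteq> (\<Pi>\<^sub>E i\<in>UNIV. {..LENGTH('b)})"
  proof
    fix \<alpha> :: "'a \<Rightarrow> nat"
    assume "\<alpha> \<in> {\<alpha>. (\<Sum>i\<in>UNIV. \<alpha> i) \<le> LENGTH('b)}"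
    then have "\<alpha> i \<le> LENGTH('b)" for i
      using member_le_sum[of i UNIV \<alpha>] by simp
    then show "\<alpha> \<in> (\<Pi>\<^sub>E i\<in>UNIV. {..LENGTH('b)})"
      by (simp add: PiE_def)
  qed
  then have "finite {\<alpha> :: 'a \<Rightarrow> nat. (\<Sum>i\<in>UNIV. \<alpha> i) \<le> LENGTH('b)}"
    by (rule finite_subset) (simp add: finite_PiE)
  then have "finite (Multi_Index ` {\<alpha> :: 'a \<Rightarrow> nat. (\<Sum>i\<in>UNIV. \<alpha> i) \<le> LENGTH('b)}
      :: ('a, 'b) multi_index set)"
    by (rule finite_imageI)
  moreover have "(UNIV :: ('a, 'b) multi_index set)
      = Multi_Index ` {\<alpha>. (\<Sum>i\<in>UNIV. \<alpha> i) \<le> LENGTH('b)}"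
    by (metis type_definition.Abs_image type_definition_multi_index)
  ultimately show "finite (UNIV :: ('a, 'b) multi_index set)"
    by simp
qed

text \<open>Points \<open>(x, u\<^sup>(\<^sup>n\<^sup>))\<close>; the coordinates of \<open>u\<^sup>(\<^sup>n\<^sup>)\<close> are indexed by multi-indices.\<close>

type_synonym ('p, 'q, 'n) jet =
  "(real, 'p) vec \<times> ((real, 'q) vec, ('p, 'n) multi_index) vec"

text \<open>
  The derivative \<open>\<partial>\<^sup>\<alpha>f\<close>.  For smooth \<open>f\<close> the order in which the partial derivatives are taken
  is immaterial, so any list containing each index \<open>i\<close> exactly \<open>\<alpha> i\<close> times may be chosen.
\<close>

definition multi_partial ::
    "('p::finite \<Rightarrow> nat) \<Rightarrow> (real^'p \<Rightarrow> 'b::real_normed_vector) \<Rightarrow> real^'p \<Rightarrow> 'b" where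
  "multi_partial \<alpha> f =
     iter_partial (map (\<lambda>i. axis i 1) (SOME is. \<forall>i. count_list is i = \<alpha> i)) f"

text \<open>The point \<open>(x, pr\<^sup>(\<^sup>n\<^sup>)u(x))\<close>.\<close>

definition jet :: "(real^'p \<Rightarrow> real^'q) \<Rightarrow> real^'p \<Rightarrow> ('p::finite, 'q::finite, 'n::len0) jet" where
  "jet u x = (x, \<chi> J. multi_partial (exponents J) u x)"

definition jet_space ::
    "((real^'p) \<times> (real^'q)) set \<Rightarrow> ('p::finite, 'q::finite, 'n::len0) jet set" where
  "jet_space M = {(x, w). (x, w $ Multi_Index (\<lambda>_. 0)) \<in> M}"

section \<open>Systems of differential equations and their classical solutions\<close>

definition graph_on :: "'a set \<Rightarrow> ('a \<Rightarrow> 'b) \<Rightarrow> ('a \<times> 'b) set" where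
  "graph_on \<Omega> u = (\<lambda>x. (x, u x)) ` \<Omega>"

definition classical_solution ::
    "((real^'p) \<times> (real^'q)) set \<Rightarrow> (('p::finite, 'q::finite, 'n::len0) jet \<Rightarrow> real^'l::finite) \<Rightarrow>
     (real^'p) set \<Rightarrow> (real^'p \<Rightarrow> real^'q) \<Rightarrow> bool" where
  "classical_solution M \<Delta> \<Omega> u \<longleftrightarrow>
     open \<Omega> \<and> smooth_on \<Omega> u \<and> graph_on \<Omega> u \<subseteq> M \<and> (\<forall>x\<in>\<Omega>. \<Delta> (jet u x) = 0)"

definition solution_variety ::
    "((real^'p) \<times> (real^'q)) set \<Rightarrow> (('p::finite, 'q::finite, 'n::len0) jet \<Rightarrow> real^'l::finite) \<Rightarrow>
     ('p, 'q, 'n) jet set" where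
  "solution_variety M \<Delta> = {z \<in> jet_space M. \<Delta> z = 0}"

definition nondegenerate ::
    "((real^'p) \<times> (real^'q)) set \<Rightarrow> (('p::finite, 'q::finite, 'n::len0) jet \<Rightarrow> real^'l::finite) \<Rightarrow>
     bool" where
  "nondegenerate M \<Delta> \<longleftrightarrow>
     (\<forall>z \<in> solution_variety M \<Delta>.
        dim (range (frechet_derivative \<Delta> (at z))) = CARD('l) \<and>
        (\<exists>\<Omega> u. fst z \<in> \<Omega> \<and> classical_solution M \<Delta> \<Omega> u \<and> jet u (fst z) = z))"

section \<open>One-parameter transformation groups\<close>

text \<open>
  A local transformation group on \<open>M\<close> whose parameter ranges over \<open>(-r, r)\<close>, where \<open>r = \<infinity>\<close> is
  allowed.  The set \<open>D\<close> consists of the pairs \<open>(\<eta>, z)\<close> for which \<open>g\<^sub>\<eta> \<cdot> z\<close> is defined.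
\<close>

definition local_one_parameter_group ::
    "ereal \<Rightarrow> 'a::euclidean_space set \<Rightarrow> (real \<times> 'a) set \<Rightarrow> (real \<Rightarrow> 'a \<Rightarrow> 'a) \<Rightarrow> bool" where
  "local_one_parameter_group r M D g \<longleftrightarrow>
     open D \<and> D \<subseteq> {\<eta>. ereal \<bar>\<eta>\<bar> < r} \<times> M \<and> {0} \<times> M \<subseteq> D \<and>
     smooth_on D (\<lambda>(\<eta>, z). g \<eta> z) \<and>
     (\<forall>(\<eta>, z)\<in>D. g \<eta> z \<in> M) \<and>
     (\<forall>z\<in>M. g 0 z = z) \<and>
     (\<forall>\<eta> \<delta> z. (\<delta>, z) \<in> D \<and> (\<eta>, g \<delta> z) \<in> D \<and> (\<eta> + \<delta>, z) \<in> D \<longrightarrow>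
        g \<eta> (g \<delta> z) = g (\<eta> + \<delta>) z) \<and>
     (\<forall>(\<eta>, z)\<in>D. (- \<eta>, g \<eta> z) \<in> D \<and> g (- \<eta>) (g \<eta> z) = z)"

text \<open>
  The transformed function \<open>g\<^sub>\<eta>u\<close> of the function \<open>u\<close> on \<open>\<Omega>\<close> is defined, and it is the
  function \<open>v\<close> on the open set \<open>\<Omega>'\<close>.
\<close>

definition transforms_to ::
    "(real \<times> 'a \<times> 'b) set \<Rightarrow> (real \<Rightarrow> 'a \<times> 'b \<Rightarrow> 'a \<times> 'b) \<Rightarrow> real \<Rightarrow>
     'a::topological_space set \<Rightarrow> ('a \<Rightarrow> 'b) \<Rightarrow> 'a set \<Rightarrow> ('a \<Rightarrow> 'b) \<Rightarrow> bool" where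
  "transforms_to D g \<eta> \<Omega> u \<Omega>' v \<longleftrightarrow>
     {\<eta>} \<times> graph_on \<Omega> u \<subseteq> D \<and> open \<Omega>' \<and> g \<eta> ` graph_on \<Omega> u = graph_on \<Omega>' v"

definition classical_symmetry_group ::
    "((real^'p) \<times> (real^'q)) set \<Rightarrow> (('p::finite, 'q::finite, 'n::len0) jet \<Rightarrow> real^'l::finite) \<Rightarrow>
     (real \<times> (real^'p) \<times> (real^'q)) set \<Rightarrow>
     (real \<Rightarrow> (real^'p) \<times> (real^'q) \<Rightarrow> (real^'p) \<times> (real^'q)) \<Rightarrow> bool" where
  "classical_symmetry_group M \<Delta> D g \<longleftrightarrow>
     (\<forall>\<eta> \<Omega> u \<Omega>' v. classical_solution M \<Delta> \<Omega> u \<and> transforms_to D g \<eta> \<Omega> u \<Omega>' v \<longrightarrow>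
        classical_solution M \<Delta> \<Omega>' v)"

definition projectable_with ::
    "(real \<times> 'a \<times> 'b) set \<Rightarrow> (real \<Rightarrow> 'a \<times> 'b \<Rightarrow> 'a \<times> 'b) \<Rightarrow>
     (real \<Rightarrow> 'a \<Rightarrow> 'a) \<Rightarrow> (real \<Rightarrow> 'a \<times> 'b \<Rightarrow> 'b) \<Rightarrow> bool" where
  "projectable_with D g \<Xi> \<Phi> \<longleftrightarrow>
     (\<forall>(\<eta>, x, u)\<in>D. g \<eta> (x, u) = (\<Xi> \<eta> x, \<Phi> \<eta> (x, u)))"

definition slowly_increasing_group ::
    "(real \<times> 'a \<times> 'b) set \<Rightarrow>
     (real \<Rightarrow> 'a::euclidean_space \<times> 'b::euclidean_space \<Rightarrow> 'a \<times> 'b) \<Rightarrow>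
     (real \<Rightarrow> 'a \<Rightarrow> 'a) \<Rightarrow> (real \<Rightarrow> 'a \<times> 'b \<Rightarrow> 'b) \<Rightarrow> bool" where
  "slowly_increasing_group D g \<Xi> \<Phi> \<longleftrightarrow>
     projectable_with D g \<Xi> \<Phi> \<and>
     (\<forall>\<eta>. slowly_increasing_snd_on {z. (\<eta>, z) \<in> D} (\<Phi> \<eta>))"

section \<open>Colombeau algebras\<close>

text \<open>
  Nets are indexed by \<open>I = (0, 1]\<close>; the values \<open>u \<epsilon>\<close> with \<open>\<epsilon> \<notin> I\<close> are irrelevant, and so are
  the values outside \<open>\<Omega>\<close>, since nets that agree on \<open>I \<times> \<Omega>\<close> have the same class below.
  For vector-valued nets one obtains the spaces \<open>\<E>\<^sub>M(\<Omega>)\<^sup>q\<close>, \<open>\<N>(\<Omega>)\<^sup>q\<close> and \<open>\<G>(\<Omega>)\<^sup>q\<close>.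
\<close>

definition moderate ::
    "'a::euclidean_space set \<Rightarrow> (real \<Rightarrow> 'a \<Rightarrow> 'b::real_normed_vector) set" where
  "moderate \<Omega> = {u. (\<forall>\<epsilon>\<in>{0<..1}. smooth_on \<Omega> (u \<epsilon>)) \<and>
     (\<forall>K vs. compact K \<and> K \<subseteq> \<Omega> \<and> set vs \<subseteq> Basis \<longrightarrow>
       (\<exists>(m::nat) (C::real). \<forall>\<^sub>F \<epsilon> in at_right 0.
          \<forall>x\<in>K. norm (iter_partial vs (u \<epsilon>) x) \<le> C * (1 / \<epsilon>) ^ m))}"

definition negligible_nets ::
    "'a::euclidean_space set \<Rightarrow> (real \<Rightarrow> 'a \<Rightarrow> 'b::real_normed_vector) set" where
  "negligible_nets \<Omega> = {u \<in> moderate \<Omega>.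
     \<forall>K vs (m::nat). compact K \<and> K \<subseteq> \<Omega> \<and> set vs \<subseteq> Basis \<longrightarrow>
       (\<exists>C::real. \<forall>\<^sub>F \<epsilon> in at_right 0.
          \<forall>x\<in>K. norm (iter_partial vs (u \<epsilon>) x) \<le> C * \<epsilon> ^ m)}"

definition colombeau_rel ::
    "'a::euclidean_space set \<Rightarrow> (real \<Rightarrow> 'a \<Rightarrow> 'b::real_normed_vector) rel" where
  "colombeau_rel \<Omega> = {(u, v). u \<in> moderate \<Omega> \<and> v \<in> moderate \<Omega> \<and>
     (\<lambda>\<epsilon> x. u \<epsilon> x - v \<epsilon> x) \<in> negligible_nets \<Omega>}"

definition colombeau ::
    "'a::euclidean_space set \<Rightarrow> (real \<Rightarrow> 'a \<Rightarrow> 'b::real_normed_vector) set set" where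
  "colombeau \<Omega> = moderate \<Omega> // colombeau_rel \<Omega>"

definition cl ::
    "'a::euclidean_space set \<Rightarrow> (real \<Rightarrow> 'a \<Rightarrow> 'b::real_normed_vector) \<Rightarrow>
     (real \<Rightarrow> 'a \<Rightarrow> 'b) set" where
  "cl \<Omega> u = colombeau_rel \<Omega> `` {u}"

text \<open>The class \<open>\<Delta>(x, pr\<^sup>(\<^sup>n\<^sup>)U)\<close>, by lifting from representatives to classes.\<close>

definition colombeau_eval ::
    "(('p::finite, 'q::finite, 'n::len0) jet \<Rightarrow> real^'l::finite) \<Rightarrow> (real^'p) set \<Rightarrow>
     (real \<Rightarrow> real^'p \<Rightarrow> real^'q) set \<Rightarrow> (real \<Rightarrow> real^'p \<Rightarrow> real^'l) set" where
  "colombeau_eval \<Delta> \<Omega> U = (\<Union>u\<in>U. cl \<Omega> (\<lambda>\<epsilon> x. \<Delta> (jet (u \<epsilon>) x)))"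

text \<open>
  Representatives of an element of \<open>\<G>(\<Omega>)\<^sup>q\<close> may take arbitrary values, so \<open>M\<close> has to contain
  all of \<open>\<Omega> \<times> \<real>\<^sup>q\<close> for \<open>\<Delta>(x, pr\<^sup>(\<^sup>n\<^sup>)U)\<close> to be meaningful.
\<close>

definition colombeau_solution ::
    "((real^'p) \<times> (real^'q)) set \<Rightarrow> (('p::finite, 'q::finite, 'n::len0) jet \<Rightarrow> real^'l::finite) \<Rightarrow>
     (real^'p) set \<Rightarrow> (real \<Rightarrow> real^'p \<Rightarrow> real^'q) set \<Rightarrow> bool" where
  "colombeau_solution M \<Delta> \<Omega> U \<longleftrightarrow>
     open \<Omega> \<and> \<Omega> \<times> UNIV \<subseteq> M \<and> U \<in> colombeau \<Omega> \<and>
     colombeau_eval \<Delta> \<Omega> U = cl \<Omega> (\<lambda>_ _. 0)"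

text \<open>
  \<open>g\<^sub>\<eta>U\<close> is defined for \<open>U \<in> \<G>(\<Omega>)\<^sup>q\<close>: as representatives may take arbitrary values, \<open>g\<^sub>\<eta>\<close> has to
  be defined on all of \<open>\<Omega> \<times> \<real>\<^sup>q\<close>, and the elements of \<open>\<G>(\<Xi>\<^sub>\<eta>(\<Omega>))\<^sup>q\<close> must be admissible in
  equations posed on \<open>M\<close>.
\<close>

definition colombeau_act_defined ::
    "('a \<times> 'b) set \<Rightarrow> (real \<times> 'a \<times> 'b) set \<Rightarrow> (real \<Rightarrow> 'a \<Rightarrow> 'a) \<Rightarrow> real \<Rightarrow> 'a set \<Rightarrow> bool" where
  "colombeau_act_defined M D \<Xi> \<eta> \<Omega> \<longleftrightarrow>
     {\<eta>} \<times> \<Omega> \<times> UNIV \<subseteq> D \<and> (\<Xi> \<eta> ` \<Omega>) \<times> UNIV \<subseteq> M"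

text \<open>The class of \<open>(\<Phi>\<^sub>g \<circ> (id \<times> u\<^sub>\<epsilon>)) \<circ> \<Xi>\<^sub>g\<^sup>-\<^sup>1\<close> in \<open>\<G>(\<Xi>\<^sub>g(\<Omega>))\<^sup>q\<close>.\<close>

definition colombeau_act ::
    "('a::euclidean_space \<Rightarrow> 'a) \<Rightarrow> ('a \<times> 'b::real_normed_vector \<Rightarrow> 'b) \<Rightarrow> 'a set \<Rightarrow>
     (real \<Rightarrow> 'a \<Rightarrow> 'b) set \<Rightarrow> (real \<Rightarrow> 'a \<Rightarrow> 'b) set" where
  "colombeau_act \<Xi>g \<Phi>g \<Omega> U =
     (\<Union>u\<in>U. cl (\<Xi>g ` \<Omega>) (\<lambda>\<epsilon>. (\<lambda>x. \<Phi>g (x, u \<epsilon> x)) \<circ> inv_into \<Omega> \<Xi>g))"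

definition colombeau_symmetry_group ::
    "((real^'p) \<times> (real^'q)) set \<Rightarrow> (('p::finite, 'q::finite, 'n::len0) jet \<Rightarrow> real^'l::finite) \<Rightarrow>
     (real \<times> (real^'p) \<times> (real^'q)) set \<Rightarrow>
     (real \<Rightarrow> real^'p \<Rightarrow> real^'p) \<Rightarrow> (real \<Rightarrow> (real^'p) \<times> (real^'q) \<Rightarrow> real^'q) \<Rightarrow> bool" where
  "colombeau_symmetry_group M \<Delta> D \<Xi> \<Phi> \<longleftrightarrow>
     (\<forall>\<eta> \<Omega> U. colombeau_solution M \<Delta> \<Omega> U \<and> colombeau_act_defined M D \<Xi> \<eta> \<Omega> \<longrightarrow>
        colombeau_solution M \<Delta> (\<Xi> \<eta> ` \<Omega>) (colombeau_act (\<Xi> \<eta>) (\<Phi> \<eta>) \<Omega> U))"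

section \<open>The factorization and the growth condition on its coefficients\<close>

text \<open>
  \<open>\<Delta>\<^sub>\<nu>(\<Xi>\<^sub>\<eta>(x), pr\<^sup>(\<^sup>n\<^sup>)(g\<^sub>\<eta>u)(\<Xi>\<^sub>\<eta>(x))) = \<Sum>\<^sub>\<mu> Q\<^sub>\<mu>\<^sub>\<nu>(\<eta>, x, pr\<^sup>(\<^sup>n\<^sup>)u(x)) \<Delta>\<^sub>\<mu>(x, pr\<^sup>(\<^sup>n\<^sup>)u(x))\<close> whenever \<open>g\<^sub>\<eta>u\<close>
  exists.  The set \<open>V\<close> is the domain of \<open>Q \<mu> \<nu> \<eta>\<close>, so the identity includes that
  \<open>(x, pr\<^sup>(\<^sup>n\<^sup>)u(x))\<close> belongs to \<open>V\<close>.
\<close>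

definition factorizes_with ::
    "(('p::finite, 'q::finite, 'n::len0) jet \<Rightarrow> real^'l::finite) \<Rightarrow>
     (real \<times> (real^'p) \<times> (real^'q)) set \<Rightarrow>
     (real \<Rightarrow> (real^'p) \<times> (real^'q) \<Rightarrow> (real^'p) \<times> (real^'q)) \<Rightarrow> (real \<Rightarrow> real^'p \<Rightarrow> real^'p) \<Rightarrow>
     ('p, 'q, 'n) jet set \<Rightarrow> ('l \<Rightarrow> 'l \<Rightarrow> real \<Rightarrow> ('p, 'q, 'n) jet \<Rightarrow> real) \<Rightarrow> bool" where
  "factorizes_with \<Delta> D g \<Xi> V Q \<longleftrightarrow>
     (\<forall>\<eta> \<Omega> u \<Omega>' v. open \<Omega> \<and> smooth_on \<Omega> u \<and> transforms_to D g \<eta> \<Omega> u \<Omega>' v \<longrightarrow>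
        (\<forall>x\<in>\<Omega>. jet u x \<in> V \<and>
           (\<forall>\<nu>. \<Delta> (jet v (\<Xi> \<eta> x)) $ \<nu> = (\<Sum>\<mu>\<in>UNIV. Q \<mu> \<nu> \<eta> (jet u x) * \<Delta> (jet u x) $ \<mu>))))"

definition moderate_coefficients ::
    "((real^'p) \<times> (real^'q)) set \<Rightarrow> (real \<times> (real^'p) \<times> (real^'q)) set \<Rightarrow>
     (real \<Rightarrow> real^'p \<Rightarrow> real^'p) \<Rightarrow>
     ('l \<Rightarrow> 'l \<Rightarrow> real \<Rightarrow> ('p::finite, 'q::finite, 'n::len0) jet \<Rightarrow> real) \<Rightarrow> bool" where
  "moderate_coefficients M D \<Xi> Q \<longleftrightarrow>
     (\<forall>\<eta> \<Omega>. open \<Omega> \<and> colombeau_act_defined M D \<Xi> \<eta> \<Omega> \<longrightarrow>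
        (\<forall>u\<in>moderate \<Omega>. \<forall>\<mu> \<nu>.
           (\<lambda>\<epsilon> y. Q \<mu> \<nu> \<eta> (jet (u \<epsilon>) (\<Xi> (- \<eta>) y))) \<in> moderate (\<Xi> \<eta> ` \<Omega>)))"

end

theory Submission
  imports Defs
begin

text \<open>
  The proof works with representatives.  Let \<open>u\<close> represent a solution \<open>U\<close> on \<open>\<Omega>\<close>.  The projected
  transformation \<open>\<Xi> \<eta>\<close> has the smooth inverse \<open>\<Xi> (- \<eta>)\<close> on its open image, so the factorization, applied to
  the smooth function \<open>u\<^sub>\<epsilon>\<close> for each fixed \<open>\<epsilon>\<close>, expresses \<open>\<Delta>\<close> on the n-jet of \<open>g\<^sub>\<eta> u\<^sub>\<epsilon>\<close> at \<open>y\<close> as a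
  combination of the components of \<open>\<Delta>\<close> on the jet of \<open>u\<^sub>\<epsilon>\<close> at \<open>\<Xi> (- \<eta>) y\<close>, with coefficients given by \<open>Q\<close>.
  The components form negligible nets, because \<open>U\<close> is a solution, and the coefficients are moderate by
  hypothesis.  A moderate net times a negligible one is negligible, so \<open>g\<^sub>\<eta> U\<close> is a solution; this is
  \<open>moderate_coefficients_imp_symmetry\<close>.

  What has to be secured is that all these operations are meaningful for classes: composing a moderate
  net with a slowly increasing function (\<open>\<Phi> \<eta>\<close>, \<open>\<Delta>\<close> or \<open>Q \<mu> \<nu> \<eta>\<close>) gives a moderate net, and negligible changes
  of the argument lead to negligible changes of the value.  Two observations carry this part.

  First, moderateness is proved by induction on the number of derivatives
  (\<open>moderate_upto_compose\<close>): the first partial derivatives of a composition are sums of products whose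
  factors are partial derivatives of the inner net and compositions of the same form.  The outer
  function is allowed to depend on \<open>\<epsilon>\<close>, so that substituting a smooth map into a moderate net, as in the
  pullback along \<open>\<Xi> (- \<eta>)\<close>, is an instance.

  Second, a moderate net is negligible as soon as its values are, without regard to derivatives
  (\<open>negligible_nets_iff\<close>).  Hence negligibility of a difference \<open>F(x, a) - F(x, a')\<close> is a matter of the mean
  value theorem (\<open>negligible_slowly_increasing_diff\<close>).

  For slowly increasing \<open>Q\<close> the coefficients are themselves such compositions with the moderate net
  of jets, which gives the second assertion (\<open>slowly_increasing_imp_moderate_coefficients\<close>).
\<close>

section \<open>Partial derivatives on open sets\<close>

lemma frechet_derivative_cong_open:
  assumes "open S" "x \<in> S" "\<And>y. y \<in> S \<Longrightarrow> f y = h y"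
  shows "frechet_derivative f (at x) = frechet_derivative h (at x)"
proof -
  have "(f has_derivative D) (at x) \<longleftrightarrow> (h has_derivative D) (at x)" for D
    using has_derivative_transform_within_open[of f D x UNIV S h]
      has_derivative_transform_within_open[of h D x UNIV S f] assms by auto
  then show ?thesis by (simp add: frechet_derivative_def)
qed

lemma iter_partial_cong_open:
  assumes "open S" "x \<in> S" "\<And>y. y \<in> S \<Longrightarrow> f y = h y"
  shows "iter_partial vs f x = iter_partial vs h x"
  using assms(3)
proof (induction vs arbitrary: f h)
  case Nil
  then show ?case using assms(2) by simp
next
  case (Cons v vs)
  have "frechet_derivative f (at y) v = frechet_derivative h (at y) v" if "y \<in> S" for y
    using frechet_derivative_cong_open[OF assms(1) that, of f h] Cons.prems by simp
  from Cons.IH[OF this] show ?case by simp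
qed

lemma smooth_on_cong_open:
  assumes "open S" "smooth_on S f" "\<And>y. y \<in> S \<Longrightarrow> f y = h y"
  shows "smooth_on S h"
  unfolding smooth_on_def
proof (intro allI impI ballI)
  fix vs :: "'a list" and x assume vs: "set vs \<subseteq> Basis" and x: "x \<in> S"
  then have "iter_partial vs f differentiable (at x)" using assms(2) by (auto simp: smooth_on_def)
  then obtain D where "(iter_partial vs f has_derivative D) (at x)" by (auto simp: differentiable_def)
  then have "(iter_partial vs h has_derivative D) (at x)"
    by (rule has_derivative_transform_within_open[OF _ assms(1) x])
      (rule iter_partial_cong_open[OF assms(1), of _ f h], simp_all add: assms(3))
  then show "iter_partial vs h differentiable (at x)" by (rule differentiableI)
qed

lemma smooth_on_partial:
  assumes "smooth_on S f" "b \<in> Basis"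
  shows "smooth_on S (\<lambda>x. frechet_derivative f (at x) b)"
  unfolding smooth_on_def
proof (intro allI impI)
  fix vs :: "'a list" assume "set vs \<subseteq> Basis"
  then show "\<forall>x\<in>S. iter_partial vs (\<lambda>x. frechet_derivative f (at x) b) differentiable (at x)"
    using assms(1)[unfolded smooth_on_def, rule_format, of "b # vs"] assms(2) by simp
qed

lemma smooth_on_iter_partial:
  assumes "smooth_on S f" "set vs \<subseteq> Basis"
  shows "smooth_on S (iter_partial vs f)"
  using assms by (induction vs arbitrary: f) (simp_all add: smooth_on_partial)

lemma smooth_on_imp_continuous_on: "smooth_on S f \<Longrightarrow> continuous_on S f"
  unfolding smooth_on_def
  by (intro continuous_at_imp_continuous_on ballI differentiable_imp_continuous_within)
    (auto dest: spec[of _ "[]"])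

lemma iter_partial_diff:
  assumes "open S" "smooth_on S f" "smooth_on S h" "x \<in> S" "set vs \<subseteq> Basis"
  shows "iter_partial vs (\<lambda>x. f x - h x) x = iter_partial vs f x - iter_partial vs h x"
  using assms(2,3,5)
proof (induction vs arbitrary: f h)
  case (Cons b vs)
  have "frechet_derivative (\<lambda>x. f x - h x) (at y) b
      = frechet_derivative f (at y) b - frechet_derivative h (at y) b" if "y \<in> S" for y
  proof -
    have "f differentiable (at y)" "h differentiable (at y)"
      using Cons.prems(1)[unfolded smooth_on_def, rule_format, of "[]"]
        Cons.prems(2)[unfolded smooth_on_def, rule_format, of "[]"] that by auto
    then have "((\<lambda>x. f x - h x) has_derivative
        (\<lambda>v. frechet_derivative f (at y) v - frechet_derivative h (at y) v)) (at y)"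
      by (intro has_derivative_diff) (simp_all add: frechet_derivative_works[symmetric])
    from fun_cong[OF frechet_derivative_at[OF this], of b] show ?thesis by simp
  qed
  then have "iter_partial (b # vs) (\<lambda>x. f x - h x) x
      = iter_partial vs (\<lambda>y. frechet_derivative f (at y) b - frechet_derivative h (at y) b) x"
    using iter_partial_cong_open[OF assms(1,4), of "\<lambda>y. frechet_derivative (\<lambda>x. f x - h x) (at y) b"
      "\<lambda>y. frechet_derivative f (at y) b - frechet_derivative h (at y) b" vs]
    by simp
  also have "\<dots> = iter_partial (b # vs) f x - iter_partial (b # vs) h x"
    using Cons.prems by (simp add: Cons.IH smooth_on_partial)
  finally show ?case .
qed simp

lemma frechet_derivative_eq_sum_Basis:
  assumes "f differentiable (at x)"
  shows "frechet_derivative f (at x) v = (\<Sum>b\<in>Basis. (v \<bullet> b) *\<^sub>R frechet_derivative f (at x) b)"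
proof -
  have l: "linear (frechet_derivative f (at x))" by (rule linear_frechet_derivative[OF assms])
  have "frechet_derivative f (at x) v = frechet_derivative f (at x) (\<Sum>b\<in>Basis. (v \<bullet> b) *\<^sub>R b)"
    by (simp add: euclidean_representation)
  also have "\<dots> = (\<Sum>b\<in>Basis. (v \<bullet> b) *\<^sub>R frechet_derivative f (at x) b)"
    by (simp add: linear_sum[OF l] linear_cmul[OF l])
  finally show ?thesis .
qed

section \<open>Moderate and negligible bounds\<close>

text \<open>
  The estimates that occur in the definitions of moderate and of negligible nets, for the values of a
  net alone.  Derivatives enter by applying them to the nets of partial derivatives.
\<close>

definition moderately_bounded ::
    "'a::euclidean_space set \<Rightarrow> (real \<Rightarrow> 'a \<Rightarrow> 'b::real_normed_vector) \<Rightarrow> bool" where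
  "moderately_bounded \<Omega> f \<longleftrightarrow> (\<forall>K. compact K \<and> K \<subseteq> \<Omega> \<longrightarrow>
     (\<exists>(m::nat) (C::real). \<forall>\<^sub>F \<epsilon> in at_right 0. \<forall>x\<in>K. norm (f \<epsilon> x) \<le> C * (1 / \<epsilon>) ^ m))"

definition negligibly_bounded ::
    "'a::euclidean_space set \<Rightarrow> (real \<Rightarrow> 'a \<Rightarrow> 'b::real_normed_vector) \<Rightarrow> bool" where
  "negligibly_bounded \<Omega> f \<longleftrightarrow> (\<forall>K (m::nat). compact K \<and> K \<subseteq> \<Omega> \<longrightarrow>
     (\<exists>C::real. \<forall>\<^sub>F \<epsilon> in at_right 0. \<forall>x\<in>K. norm (f \<epsilon> x) \<le> C * \<epsilon> ^ m))"

lemma eventually_in_index_set: "\<forall>\<^sub>F \<epsilon>::real in at_right 0. \<epsilon> \<in> {0<..1}"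
  unfolding eventually_at_right_field by (rule exI[of _ 1]) auto

lemma moderately_boundedE:
  assumes "moderately_bounded \<Omega> f" "compact K" "K \<subseteq> \<Omega>"
  obtains m :: nat and C :: real where "C \<ge> 0"
    "\<forall>\<^sub>F \<epsilon> in at_right 0. \<forall>x\<in>K. norm (f \<epsilon> x) \<le> C * (1 / \<epsilon>) ^ m"
proof -
  obtain m C where *: "\<forall>\<^sub>F \<epsilon> in at_right 0. \<forall>x\<in>K. norm (f \<epsilon> x) \<le> C * (1 / \<epsilon>) ^ m"
    using assms unfolding moderately_bounded_def by blast
  have "\<forall>\<^sub>F \<epsilon> in at_right 0. \<forall>x\<in>K. norm (f \<epsilon> x) \<le> \<bar>C\<bar> * (1 / \<epsilon>) ^ m"
    using * eventually_in_index_set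
  proof eventually_elim
    case (elim \<epsilon>)
    have "C * (1 / \<epsilon>) ^ m \<le> \<bar>C\<bar> * (1 / \<epsilon>) ^ m"
      using elim by (intro mult_right_mono) auto
    then show ?case using elim(1) by (meson order_trans)
  qed
  then show ?thesis using that[of "\<bar>C\<bar>" m] by simp
qed

lemma negligibly_boundedE:
  assumes "negligibly_bounded \<Omega> f" "compact K" "K \<subseteq> \<Omega>"
  obtains C :: real where "C \<ge> 0"
    "\<forall>\<^sub>F \<epsilon> in at_right 0. \<forall>x\<in>K. norm (f \<epsilon> x) \<le> C * \<epsilon> ^ m"
proof -
  obtain C where *: "\<forall>\<^sub>F \<epsilon> in at_right 0. \<forall>x\<in>K. norm (f \<epsilon> x) \<le> C * \<epsilon> ^ m"
    using assms unfolding negligibly_bounded_def by blast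
  have "\<forall>\<^sub>F \<epsilon> in at_right 0. \<forall>x\<in>K. norm (f \<epsilon> x) \<le> \<bar>C\<bar> * \<epsilon> ^ m"
    using * eventually_in_index_set
  proof eventually_elim
    case (elim \<epsilon>)
    have "C * \<epsilon> ^ m \<le> \<bar>C\<bar> * \<epsilon> ^ m"
      using elim by (intro mult_right_mono) auto
    then show ?case using elim(1) by (meson order_trans)
  qed
  then show ?thesis using that[of "\<bar>C\<bar>"] by simp
qed

lemma moderately_bounded_cong:
  assumes "\<And>\<epsilon> x. \<epsilon> \<in> {0<..1} \<Longrightarrow> x \<in> \<Omega> \<Longrightarrow> f \<epsilon> x = h \<epsilon> x"
  shows "moderately_bounded \<Omega> f \<longleftrightarrow> moderately_bounded \<Omega> h"
proof -
  have "(\<forall>\<^sub>F \<epsilon> in at_right 0. \<forall>x\<in>K. norm (f \<epsilon> x) \<le> C * (1 / \<epsilon>) ^ m) \<longleftrightarrow>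
        (\<forall>\<^sub>F \<epsilon> in at_right 0. \<forall>x\<in>K. norm (h \<epsilon> x) \<le> C * (1 / \<epsilon>) ^ m)"
    if "K \<subseteq> \<Omega>" for K m and C :: real
    by (intro eventually_cong[OF eventually_in_index_set]) (use assms that in \<open>auto simp: subset_iff\<close>)
  then show ?thesis unfolding moderately_bounded_def by (simp cong: conj_cong imp_cong)
qed

lemma negligibly_bounded_cong:
  assumes "\<And>\<epsilon> x. \<epsilon> \<in> {0<..1} \<Longrightarrow> x \<in> \<Omega> \<Longrightarrow> f \<epsilon> x = h \<epsilon> x"
  shows "negligibly_bounded \<Omega> f \<longleftrightarrow> negligibly_bounded \<Omega> h"
proof -
  have "(\<forall>\<^sub>F \<epsilon> in at_right 0. \<forall>x\<in>K. norm (f \<epsilon> x) \<le> C * \<epsilon> ^ m) \<longleftrightarrow>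
        (\<forall>\<^sub>F \<epsilon> in at_right 0. \<forall>x\<in>K. norm (h \<epsilon> x) \<le> C * \<epsilon> ^ m)"
    if "K \<subseteq> \<Omega>" for K m and C :: real
    by (intro eventually_cong[OF eventually_in_index_set]) (use assms that in \<open>auto simp: subset_iff\<close>)
  then show ?thesis unfolding negligibly_bounded_def by (simp cong: conj_cong imp_cong)
qed

lemma inverse_powers_le:
  fixes \<epsilon> :: real assumes "\<epsilon> \<in> {0<..1}" "m \<le> n"
  shows "(1 / \<epsilon>) ^ m \<le> (1 / \<epsilon>) ^ n"
  using assms by (intro power_increasing) auto

text \<open>
  The mechanism behind slow increase: a power of a power of \<open>1 / \<epsilon>\<close> is again one.
\<close>

lemma moderately_bounded_polynomial:
  assumes "moderately_bounded \<Omega> h"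
    and "\<And>K. compact K \<Longrightarrow> K \<subseteq> \<Omega> \<Longrightarrow> \<exists>C\<ge>0. \<exists>k. \<forall>\<epsilon>\<in>{0<..1}. \<forall>x\<in>K.
           norm (f \<epsilon> x) \<le> C * (1 + norm (h \<epsilon> x)) ^ k"
  shows "moderately_bounded \<Omega> f"
  unfolding moderately_bounded_def
proof (intro allI impI; elim conjE)
  fix K assume K: "compact K" "K \<subseteq> \<Omega>"
  obtain m A where A: "A \<ge> 0" "\<forall>\<^sub>F \<epsilon> in at_right 0. \<forall>x\<in>K. norm (h \<epsilon> x) \<le> A * (1 / \<epsilon>) ^ m"
    using moderately_boundedE[OF assms(1) K] by blast
  obtain C k where C: "C \<ge> 0" "\<And>\<epsilon> x. \<epsilon> \<in> {0<..1} \<Longrightarrow> x\<in>K \<Longrightarrow>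
      norm (f \<epsilon> x) \<le> C * (1 + norm (h \<epsilon> x)) ^ k"
    using assms(2)[OF K] by blast
  have "\<forall>\<^sub>F \<epsilon> in at_right 0. \<forall>x\<in>K. norm (f \<epsilon> x) \<le> (C * (1 + A) ^ k) * (1 / \<epsilon>) ^ (m * k)"
    using A(2) eventually_in_index_set
  proof eventually_elim
    case (elim \<epsilon>)
    show ?case
    proof
      fix x assume x: "x \<in> K"
      have "1 \<le> (1 / \<epsilon>) ^ m" using inverse_powers_le[of \<epsilon> 0 m] elim by simp
      then have "1 + norm (h \<epsilon> x) \<le> (1 + A) * (1 / \<epsilon>) ^ m"
        using elim x by (auto simp: distrib_right intro: add_mono)
      then have "(1 + norm (h \<epsilon> x)) ^ k \<le> ((1 + A) * (1 / \<epsilon>) ^ m) ^ k"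
        by (intro power_mono) auto
      then have "C * (1 + norm (h \<epsilon> x)) ^ k \<le> C * ((1 + A) * (1 / \<epsilon>) ^ m) ^ k"
        using C(1) by (intro mult_left_mono) auto
      also have "\<dots> = (C * (1 + A) ^ k) * (1 / \<epsilon>) ^ (m * k)"
        by (simp add: power_mult_distrib power_mult power_divide)
      finally show "norm (f \<epsilon> x) \<le> (C * (1 + A) ^ k) * (1 / \<epsilon>) ^ (m * k)"
        using C(2)[of \<epsilon> x] elim x by linarith
    qed
  qed
  then show "\<exists>m C. \<forall>\<^sub>F \<epsilon> in at_right 0. \<forall>x\<in>K. norm (f \<epsilon> x) \<le> C * (1 / \<epsilon>) ^ m" by blast
qed

lemma moderately_bounded_linear:
  assumes "bounded_linear T" "moderately_bounded \<Omega> f"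
  shows "moderately_bounded \<Omega> (\<lambda>\<epsilon> x. T (f \<epsilon> x))"
proof (rule moderately_bounded_polynomial[OF assms(2)])
  obtain C where C: "C > 0" "\<And>y. norm (T y) \<le> norm y * C"
    using bounded_linear.pos_bounded[OF assms(1)] by blast
  have "norm (T (f \<epsilon> x)) \<le> C * (1 + norm (f \<epsilon> x)) ^ 1" for \<epsilon> x
    using C(2)[of "f \<epsilon> x"] C(1) by (simp add: algebra_simps)
  then show "\<exists>C\<ge>0. \<exists>k. \<forall>\<epsilon>\<in>{0<..1}. \<forall>x\<in>K. norm (T (f \<epsilon> x)) \<le> C * (1 + norm (f \<epsilon> x)) ^ k" for K
    using C(1) by (intro exI[of _ C] exI[of _ 1] conjI ballI) auto
qed

lemma moderately_bounded_add:
  assumes "moderately_bounded \<Omega> f" "moderately_bounded \<Omega> h"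
  shows "moderately_bounded \<Omega> (\<lambda>\<epsilon> x. f \<epsilon> x + h \<epsilon> x)"
  unfolding moderately_bounded_def
proof (intro allI impI; elim conjE)
  fix K assume K: "compact K" "K \<subseteq> \<Omega>"
  obtain m A where A: "A \<ge> 0" "\<forall>\<^sub>F \<epsilon> in at_right 0. \<forall>x\<in>K. norm (f \<epsilon> x) \<le> A * (1 / \<epsilon>) ^ m"
    using moderately_boundedE[OF assms(1) K] by blast
  obtain n B where B: "B \<ge> 0" "\<forall>\<^sub>F \<epsilon> in at_right 0. \<forall>x\<in>K. norm (h \<epsilon> x) \<le> B * (1 / \<epsilon>) ^ n"
    using moderately_boundedE[OF assms(2) K] by blast
  have "\<forall>\<^sub>F \<epsilon> in at_right 0. \<forall>x\<in>K. norm (f \<epsilon> x + h \<epsilon> x) \<le> (A + B) * (1 / \<epsilon>) ^ (max m n)"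
    using A(2) B(2) eventually_in_index_set
  proof eventually_elim
    case (elim \<epsilon>)
    have "A * (1 / \<epsilon>) ^ m \<le> A * (1 / \<epsilon>) ^ (max m n)" "B * (1 / \<epsilon>) ^ n \<le> B * (1 / \<epsilon>) ^ (max m n)"
      using A(1) B(1) inverse_powers_le elim by (auto intro!: mult_left_mono simp del: power_one_over)
    then have le: "A * (1 / \<epsilon>) ^ m + B * (1 / \<epsilon>) ^ n \<le> (A + B) * (1 / \<epsilon>) ^ (max m n)"
      unfolding distrib_right by (rule add_mono)
    show ?case
    proof
      fix x assume x: "x \<in> K"
      have "norm (f \<epsilon> x + h \<epsilon> x) \<le> A * (1 / \<epsilon>) ^ m + B * (1 / \<epsilon>) ^ n"
        using elim x by (intro norm_triangle_le add_mono) auto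
      with le show "norm (f \<epsilon> x + h \<epsilon> x) \<le> (A + B) * (1 / \<epsilon>) ^ (max m n)" by linarith
    qed
  qed
  then show "\<exists>m C. \<forall>\<^sub>F \<epsilon> in at_right 0. \<forall>x\<in>K. norm (f \<epsilon> x + h \<epsilon> x) \<le> C * (1 / \<epsilon>) ^ m" by blast
qed

lemma moderately_bounded_scaleR:
  assumes "moderately_bounded \<Omega> f" "moderately_bounded \<Omega> h"
  shows "moderately_bounded \<Omega> (\<lambda>\<epsilon> x. f \<epsilon> x *\<^sub>R h \<epsilon> x)"
  unfolding moderately_bounded_def
proof (intro allI impI; elim conjE)
  fix K assume K: "compact K" "K \<subseteq> \<Omega>"
  obtain m A where A: "A \<ge> 0" "\<forall>\<^sub>F \<epsilon> in at_right 0. \<forall>x\<in>K. norm (f \<epsilon> x) \<le> A * (1 / \<epsilon>) ^ m"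
    using moderately_boundedE[OF assms(1) K] by blast
  obtain n B where B: "B \<ge> 0" "\<forall>\<^sub>F \<epsilon> in at_right 0. \<forall>x\<in>K. norm (h \<epsilon> x) \<le> B * (1 / \<epsilon>) ^ n"
    using moderately_boundedE[OF assms(2) K] by blast
  have "\<forall>\<^sub>F \<epsilon> in at_right 0. \<forall>x\<in>K. norm (f \<epsilon> x *\<^sub>R h \<epsilon> x) \<le> (A * B) * (1 / \<epsilon>) ^ (m + n)"
    using A(2) B(2) eventually_in_index_set
  proof eventually_elim
    case (elim \<epsilon>)
    show ?case
    proof
      fix x assume x: "x \<in> K"
      have "norm (f \<epsilon> x *\<^sub>R h \<epsilon> x) = norm (f \<epsilon> x) * norm (h \<epsilon> x)" by simp
      also have "\<dots> \<le> (A * (1 / \<epsilon>) ^ m) * (B * (1 / \<epsilon>) ^ n)"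
        using elim x A(1) by (intro mult_mono) auto
      finally show "norm (f \<epsilon> x *\<^sub>R h \<epsilon> x) \<le> (A * B) * (1 / \<epsilon>) ^ (m + n)"
        by (simp add: power_add mult_ac)
    qed
  qed
  then show "\<exists>m C. \<forall>\<^sub>F \<epsilon> in at_right 0. \<forall>x\<in>K. norm (f \<epsilon> x *\<^sub>R h \<epsilon> x) \<le> C * (1 / \<epsilon>) ^ m" by blast
qed

lemma moderately_bounded_compose:
  assumes "moderately_bounded \<Omega> f" "continuous_on \<Omega>' \<psi>" "\<psi> ` \<Omega>' \<subseteq> \<Omega>"
  shows "moderately_bounded \<Omega>' (\<lambda>\<epsilon> y. f \<epsilon> (\<psi> y))"
  unfolding moderately_bounded_def
proof (intro allI impI; elim conjE)
  fix K assume K: "compact K" "K \<subseteq> \<Omega>'"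
  have "compact (\<psi> ` K)" "\<psi> ` K \<subseteq> \<Omega>"
    using K assms(3) compact_continuous_image[OF continuous_on_subset[OF assms(2) K(2)] K(1)] by auto
  then show "\<exists>m C. \<forall>\<^sub>F \<epsilon> in at_right 0. \<forall>x\<in>K. norm (f \<epsilon> (\<psi> x)) \<le> C * (1 / \<epsilon>) ^ m"
    using assms(1)[unfolded moderately_bounded_def, rule_format, of "\<psi> ` K"] by simp
qed

lemma moderately_bounded_continuous:
  assumes "continuous_on \<Omega> f"
  shows "moderately_bounded \<Omega> (\<lambda>_. f)"
  unfolding moderately_bounded_def
proof (intro allI impI; elim conjE)
  fix K assume K: "compact K" "K \<subseteq> \<Omega>"
  have "bounded (f ` K)"
    using K by (intro compact_imp_bounded compact_continuous_image continuous_on_subset[OF assms])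
  then obtain B where "\<forall>x\<in>K. norm (f x) \<le> B"
    by (auto simp: bounded_iff)
  then show "\<exists>m C. \<forall>\<^sub>F \<epsilon> in at_right 0. \<forall>x\<in>K. norm (f x) \<le> C * (1 / \<epsilon>) ^ m"
    by (intro exI[of _ 0] exI[of _ B]) simp
qed

lemma negligibly_bounded_add:
  assumes "negligibly_bounded \<Omega> f" "negligibly_bounded \<Omega> h"
  shows "negligibly_bounded \<Omega> (\<lambda>\<epsilon> x. f \<epsilon> x + h \<epsilon> x)"
  unfolding negligibly_bounded_def
proof (intro allI impI; elim conjE)
  fix K and m :: nat assume K: "compact K" "K \<subseteq> \<Omega>"
  obtain A where A: "A \<ge> 0" "\<forall>\<^sub>F \<epsilon> in at_right 0. \<forall>x\<in>K. norm (f \<epsilon> x) \<le> A * \<epsilon> ^ m"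
    using negligibly_boundedE[OF assms(1) K] by blast
  obtain B where B: "B \<ge> 0" "\<forall>\<^sub>F \<epsilon> in at_right 0. \<forall>x\<in>K. norm (h \<epsilon> x) \<le> B * \<epsilon> ^ m"
    using negligibly_boundedE[OF assms(2) K] by blast
  have "\<forall>\<^sub>F \<epsilon> in at_right 0. \<forall>x\<in>K. norm (f \<epsilon> x + h \<epsilon> x) \<le> (A + B) * \<epsilon> ^ m"
    using A(2) B(2) by eventually_elim (auto intro!: norm_triangle_le add_mono simp: distrib_right)
  then show "\<exists>C. \<forall>\<^sub>F \<epsilon> in at_right 0. \<forall>x\<in>K. norm (f \<epsilon> x + h \<epsilon> x) \<le> C * \<epsilon> ^ m" by blast
qed

lemma negligibly_bounded_minus:
  "negligibly_bounded \<Omega> (\<lambda>\<epsilon> x. - f \<epsilon> x) \<longleftrightarrow> negligibly_bounded \<Omega> f"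
  by (simp add: negligibly_bounded_def)

text \<open>
  A power of \<open>1 / \<epsilon>\<close> is absorbed by a negligible factor, since the latter decays with any prescribed order.
\<close>

lemma negligibly_bounded_dominated:
  assumes "moderately_bounded \<Omega> f" "negligibly_bounded \<Omega> h"
    and "\<And>\<epsilon> x. \<epsilon> \<in> {0<..1} \<Longrightarrow> x \<in> \<Omega> \<Longrightarrow> norm (k \<epsilon> x) \<le> norm (f \<epsilon> x) * norm (h \<epsilon> x)"
  shows "negligibly_bounded \<Omega> k"
  unfolding negligibly_bounded_def
proof (intro allI impI; elim conjE)
  fix K and m :: nat assume K: "compact K" "K \<subseteq> \<Omega>"
  obtain n A where A: "A \<ge> 0" "\<forall>\<^sub>F \<epsilon> in at_right 0. \<forall>x\<in>K. norm (f \<epsilon> x) \<le> A * (1 / \<epsilon>) ^ n"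
    using moderately_boundedE[OF assms(1) K] by blast
  obtain B where B: "B \<ge> 0" "\<forall>\<^sub>F \<epsilon> in at_right 0. \<forall>x\<in>K. norm (h \<epsilon> x) \<le> B * \<epsilon> ^ (m + n)"
    using negligibly_boundedE[OF assms(2) K] by blast
  have "\<forall>\<^sub>F \<epsilon> in at_right 0. \<forall>x\<in>K. norm (k \<epsilon> x) \<le> (A * B) * \<epsilon> ^ m"
    using A(2) B(2) eventually_in_index_set
  proof eventually_elim
    case (elim \<epsilon>)
    show ?case
    proof
      fix x assume x: "x \<in> K"
      have "norm (k \<epsilon> x) \<le> norm (f \<epsilon> x) * norm (h \<epsilon> x)"
        using assms(3) elim x K by blast
      also have "\<dots> \<le> (A * (1 / \<epsilon>) ^ n) * (B * \<epsilon> ^ (m + n))"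
        using elim x A(1) by (intro mult_mono) auto
      also have "\<dots> = (A * B) * \<epsilon> ^ m"
        using elim by (simp add: power_add power_divide)
      finally show "norm (k \<epsilon> x) \<le> (A * B) * \<epsilon> ^ m" .
    qed
  qed
  then show "\<exists>C. \<forall>\<^sub>F \<epsilon> in at_right 0. \<forall>x\<in>K. norm (k \<epsilon> x) \<le> C * \<epsilon> ^ m" by blast
qed

lemma negligibly_bounded_le:
  assumes "negligibly_bounded \<Omega> h" "\<And>\<epsilon> x. \<epsilon> \<in> {0<..1} \<Longrightarrow> x \<in> \<Omega> \<Longrightarrow> norm (k \<epsilon> x) \<le> norm (h \<epsilon> x)"
  shows "negligibly_bounded \<Omega> k"
  by (rule negligibly_bounded_dominated[OF moderately_bounded_continuous[OF continuous_on_const[of _ "1::real"]] assms(1)])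
    (use assms(2) in simp)

lemma negligibly_bounded_sum:
  assumes "finite I" "\<And>i. i \<in> I \<Longrightarrow> negligibly_bounded \<Omega> (f i)"
  shows "negligibly_bounded \<Omega> (\<lambda>\<epsilon> x. \<Sum>i\<in>I. f i \<epsilon> x)"
  using assms
proof (induction I rule: finite_induct)
  case empty
  show ?case unfolding negligibly_bounded_def by (intro allI impI exI[of _ 0]) simp
next
  case (insert i I)
  then show ?case using negligibly_bounded_add[of \<Omega> "f i" "\<lambda>\<epsilon> x. \<Sum>i\<in>I. f i \<epsilon> x"] by simp
qed

lemma negligibly_bounded_vec:
  assumes "\<And>i. negligibly_bounded \<Omega> (\<lambda>\<epsilon> x. f \<epsilon> x $ i)"
  shows "negligibly_bounded \<Omega> f"
proof (rule negligibly_bounded_le)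
  show "negligibly_bounded \<Omega> (\<lambda>\<epsilon> x. \<Sum>i\<in>UNIV. norm (f \<epsilon> x $ i))"
  proof (rule negligibly_bounded_sum)
    show "negligibly_bounded \<Omega> (\<lambda>\<epsilon> x. norm (f \<epsilon> x $ i))" for i
      using assms[of i] by (simp add: negligibly_bounded_def)
  qed simp
  show "norm (f \<epsilon> x) \<le> norm (\<Sum>i\<in>UNIV. norm (f \<epsilon> x $ i))" for \<epsilon> x
    unfolding norm_vec_def[of "f \<epsilon> x"]
    using L2_set_le_sum[of UNIV "\<lambda>i. norm (f \<epsilon> x $ i)"] by (simp add: sum_nonneg)
qed

lemma negligibly_bounded_compose:
  assumes "negligibly_bounded \<Omega> f" "continuous_on \<Omega>' \<psi>" "\<psi> ` \<Omega>' \<subseteq> \<Omega>"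
  shows "negligibly_bounded \<Omega>' (\<lambda>\<epsilon> y. f \<epsilon> (\<psi> y))"
  unfolding negligibly_bounded_def
proof (intro allI impI; elim conjE)
  fix K and m :: nat assume K: "compact K" "K \<subseteq> \<Omega>'"
  have "compact (\<psi> ` K)" "\<psi> ` K \<subseteq> \<Omega>"
    using K assms(3) compact_continuous_image[OF continuous_on_subset[OF assms(2) K(2)] K(1)] by auto
  then show "\<exists>C. \<forall>\<^sub>F \<epsilon> in at_right 0. \<forall>x\<in>K. norm (f \<epsilon> (\<psi> x)) \<le> C * \<epsilon> ^ m"
    using assms(1)[unfolded negligibly_bounded_def, rule_format, of "\<psi> ` K"] by simp
qed

section \<open>Closure properties of moderate nets\<close>

abbreviation net_partial ::
    "'a::real_normed_vector \<Rightarrow> (real \<Rightarrow> 'a \<Rightarrow> 'b::real_normed_vector) \<Rightarrow> real \<Rightarrow> 'a \<Rightarrow> 'b" where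
  "net_partial b f \<equiv> \<lambda>\<epsilon> x. frechet_derivative (f \<epsilon>) (at x) b"

text \<open>
  Differentiability is included so that the derivatives of such a net are meaningful; a net is moderate
  if and only if all its nets of iterated partial derivatives have this property.
\<close>

definition moderate_C0 ::
    "'a::euclidean_space set \<Rightarrow> (real \<Rightarrow> 'a \<Rightarrow> 'b::real_normed_vector) \<Rightarrow> bool" where
  "moderate_C0 \<Omega> f \<longleftrightarrow>
     (\<forall>\<epsilon>\<in>{0<..1}. \<forall>x\<in>\<Omega>. f \<epsilon> differentiable (at x)) \<and> moderately_bounded \<Omega> f"

text \<open>
  Moderateness of the derivatives of order at most \<open>k\<close>, in the recursive form that permits proofs by
  induction on \<open>k\<close> in which only first derivatives are computed.
\<close>

primrec moderate_upto ::
    "nat \<Rightarrow> 'a::euclidean_space set \<Rightarrow> (real \<Rightarrow> 'a \<Rightarrow> 'b::real_normed_vector) \<Rightarrow> bool" where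
  "moderate_upto 0 \<Omega> f \<longleftrightarrow> moderate_C0 \<Omega> f"
| "moderate_upto (Suc k) \<Omega> f \<longleftrightarrow>
     moderate_C0 \<Omega> f \<and> (\<forall>b\<in>Basis. moderate_upto k \<Omega> (net_partial b f))"

lemma moderate_upto_iff:
  "moderate_upto k \<Omega> f \<longleftrightarrow>
     (\<forall>vs. set vs \<subseteq> Basis \<and> length vs \<le> k \<longrightarrow> moderate_C0 \<Omega> (\<lambda>\<epsilon>. iter_partial vs (f \<epsilon>)))"
proof (induction k arbitrary: f)
  case 0
  then show ?case by auto
next
  case (Suc k)
  show ?case (is "?L \<longleftrightarrow> ?R")
  proof
    assume L: ?L
    show ?R
    proof (intro allI impI)
      fix vs :: "'a list" assume vs: "set vs \<subseteq> Basis \<and> length vs \<le> Suc k"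
      show "moderate_C0 \<Omega> (\<lambda>\<epsilon>. iter_partial vs (f \<epsilon>))"
        using L vs by (cases vs) (auto simp: Suc.IH)
    qed
  next
    assume R: ?R
    have "moderate_C0 \<Omega> f" using R[rule_format, of "[]"] by simp
    moreover have "moderate_upto k \<Omega> (net_partial b f)" if "b \<in> Basis" for b
      unfolding Suc.IH
    proof (intro allI impI)
      fix vs :: "'a list" assume vs: "set vs \<subseteq> Basis \<and> length vs \<le> k"
      then show "moderate_C0 \<Omega> (\<lambda>\<epsilon>. iter_partial vs (net_partial b f \<epsilon>))"
        using R[rule_format, of "b # vs"] that by simp
    qed
    ultimately show ?L by simp
  qed
qed

lemma moderate_iff_iter_partial:
  "f \<in> moderate \<Omega> \<longleftrightarrow> (\<forall>vs. set vs \<subseteq> Basis \<longrightarrow> moderate_C0 \<Omega> (\<lambda>\<epsilon>. iter_partial vs (f \<epsilon>)))"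
  unfolding moderate_def moderate_C0_def moderately_bounded_def smooth_on_def by blast

lemma moderate_iff_upto: "f \<in> moderate \<Omega> \<longleftrightarrow> (\<forall>k. moderate_upto k \<Omega> f)"
  unfolding moderate_iff_iter_partial moderate_upto_iff by blast

lemma moderate_net_partial: "f \<in> moderate \<Omega> \<Longrightarrow> b \<in> Basis \<Longrightarrow> net_partial b f \<in> moderate \<Omega>"
  unfolding moderate_iff_upto by (metis moderate_upto.simps(2))

lemma moderate_iter_partial:
  assumes "f \<in> moderate \<Omega>" "set vs \<subseteq> Basis"
  shows "(\<lambda>\<epsilon>. iter_partial vs (f \<epsilon>)) \<in> moderate \<Omega>"
  using assms
proof (induction vs arbitrary: f)
  case (Cons b vs)
  then show ?case using Cons.IH[of "net_partial b f"] moderate_net_partial[of f \<Omega> b] by simp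
qed simp

lemma moderate_upto_imp_C0: "moderate_upto k \<Omega> f \<Longrightarrow> moderate_C0 \<Omega> f"
  by (cases k) auto

lemma moderate_upto_mono: "moderate_upto k \<Omega> f \<Longrightarrow> j \<le> k \<Longrightarrow> moderate_upto j \<Omega> f"
  unfolding moderate_upto_iff by auto

lemma moderate_upto_partial:
  "moderate_upto k \<Omega> f \<Longrightarrow> j < k \<Longrightarrow> b \<in> Basis \<Longrightarrow> moderate_upto j \<Omega> (net_partial b f)"
  using moderate_upto_mono[of k \<Omega> f "Suc j"] by simp

lemma moderate_C0_has_derivative:
  "moderate_C0 \<Omega> f \<Longrightarrow> \<epsilon> \<in> {0<..1} \<Longrightarrow> x \<in> \<Omega> \<Longrightarrow>
    (f \<epsilon> has_derivative frechet_derivative (f \<epsilon>) (at x)) (at x)"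
  by (auto simp: moderate_C0_def frechet_derivative_works[symmetric])

lemma moderate_differentiable:
  "f \<in> moderate \<Omega> \<Longrightarrow> \<epsilon> \<in> {0<..1} \<Longrightarrow> x \<in> \<Omega> \<Longrightarrow> f \<epsilon> differentiable (at x)"
  using moderate_iff_upto moderate_upto_imp_C0 moderate_C0_def by blast

lemma moderate_moderately_bounded: "f \<in> moderate \<Omega> \<Longrightarrow> moderately_bounded \<Omega> f"
  using moderate_iff_upto moderate_upto_imp_C0 moderate_C0_def by blast

lemma moderate_imp_smooth: "f \<in> moderate \<Omega> \<Longrightarrow> \<epsilon> \<in> {0<..1} \<Longrightarrow> smooth_on \<Omega> (f \<epsilon>)"
  by (auto simp: moderate_def)

lemma moderate_C0_cong:
  assumes "open \<Omega>" "\<And>\<epsilon> x. \<epsilon> \<in> {0<..1} \<Longrightarrow> x \<in> \<Omega> \<Longrightarrow> f \<epsilon> x = h \<epsilon> x" "moderate_C0 \<Omega> f"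
  shows "moderate_C0 \<Omega> h"
proof -
  have "h \<epsilon> differentiable (at x)" if "\<epsilon> \<in> {0<..1}" "x \<in> \<Omega>" for \<epsilon> x
    using moderate_C0_has_derivative[OF assms(3) that] assms(2)[OF that(1)] assms(1) that(2)
    by (meson differentiableI has_derivative_transform_within_open)
  moreover have "moderately_bounded \<Omega> h"
    using assms(3) moderately_bounded_cong[of \<Omega> f h] assms(2) by (auto simp: moderate_C0_def)
  ultimately show ?thesis by (auto simp: moderate_C0_def)
qed

lemma moderate_upto_cong:
  assumes "open \<Omega>" "\<And>\<epsilon> x. \<epsilon> \<in> {0<..1} \<Longrightarrow> x \<in> \<Omega> \<Longrightarrow> f \<epsilon> x = h \<epsilon> x" "moderate_upto k \<Omega> f"
  shows "moderate_upto k \<Omega> h"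
  using assms(2,3)
proof (induction k arbitrary: f h)
  case 0
  then show ?case using moderate_C0_cong[OF assms(1)] by (metis moderate_upto.simps(1))
next
  case (Suc k)
  have f: "moderate_C0 \<Omega> f" using Suc.prems(2) by simp
  have "moderate_upto k \<Omega> (net_partial b h)" if b: "b \<in> Basis" for b
  proof (rule Suc.IH[of "net_partial b f"])
    show "net_partial b f \<epsilon> x = net_partial b h \<epsilon> x" if "\<epsilon> \<in> {0<..1}" "x \<in> \<Omega>" for \<epsilon> x
      using frechet_derivative_cong_open[OF assms(1) that(2), of "f \<epsilon>" "h \<epsilon>"] Suc.prems(1)[OF that(1)]
      by simp
    show "moderate_upto k \<Omega> (net_partial b f)" using Suc.prems(2) b by simp
  qed
  moreover have "moderate_C0 \<Omega> h" using moderate_C0_cong[OF assms(1) Suc.prems(1) f] by blast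
  ultimately show ?case by simp
qed

lemma moderate_cong:
  assumes "open \<Omega>" "\<And>\<epsilon> x. \<epsilon> \<in> {0<..1} \<Longrightarrow> x \<in> \<Omega> \<Longrightarrow> f \<epsilon> x = h \<epsilon> x" "f \<in> moderate \<Omega>"
  shows "h \<in> moderate \<Omega>"
  using assms(3) moderate_upto_cong[OF assms(1), of f h] assms(2) unfolding moderate_iff_upto by blast

text \<open>
  The induction step used for sums, products and compositions.  It requires only bounds on the net
  itself and moderateness of lower order for any expression \<open>f'\<close> of its total derivative.
\<close>

lemma moderate_uptoI:
  assumes "open \<Omega>" "moderately_bounded \<Omega> f"
    and f': "\<And>\<epsilon> x. \<epsilon> \<in> {0<..1} \<Longrightarrow> x \<in> \<Omega> \<Longrightarrow> (f \<epsilon> has_derivative f' \<epsilon> x) (at x)"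
    and partials: "\<And>j b. j < k \<Longrightarrow> b \<in> Basis \<Longrightarrow> moderate_upto j \<Omega> (\<lambda>\<epsilon> x. f' \<epsilon> x b)"
  shows "moderate_upto k \<Omega> f"
proof -
  have C0: "moderate_C0 \<Omega> f"
    unfolding moderate_C0_def using assms(2) differentiableI[OF f'] by blast
  have partial: "moderate_upto j \<Omega> (net_partial b f)" if "j < k" and b: "b \<in> Basis" for j b
    by (rule moderate_upto_cong[OF assms(1) _ partials[OF that]])
      (use frechet_derivative_at[OF f'] in auto)
  show ?thesis
    using C0 partial by (cases k) auto
qed

lemma moderate_upto_const:
  assumes "open \<Omega>"
  shows "moderate_upto k \<Omega> (\<lambda>_ _. c)"
proof (induction k arbitrary: c rule: less_induct)
  case (less k)
  show ?case
    by (rule moderate_uptoI[OF assms, where f' = "\<lambda>_ _ _. 0"])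
      (auto intro: moderately_bounded_continuous less.IH)
qed

lemma moderate_upto_linear:
  assumes "open \<Omega>" "bounded_linear T" "moderate_upto k \<Omega> f"
  shows "moderate_upto k \<Omega> (\<lambda>\<epsilon> x. T (f \<epsilon> x))"
  using assms(3)
proof (induction k arbitrary: f rule: less_induct)
  case (less k)
  have f: "moderate_C0 \<Omega> f" by (rule moderate_upto_imp_C0[OF less.prems])
  show ?case
  proof (rule moderate_uptoI[OF assms(1)])
    show "moderately_bounded \<Omega> (\<lambda>\<epsilon> x. T (f \<epsilon> x))"
      using f by (simp add: moderately_bounded_linear[OF assms(2)] moderate_C0_def)
    show "moderate_upto j \<Omega> (\<lambda>\<epsilon> x. T (frechet_derivative (f \<epsilon>) (at x) b))"
      if "j < k" "b \<in> Basis" for j b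
      by (rule less.IH[OF that(1) moderate_upto_partial[OF less.prems that]])
  qed (rule bounded_linear.has_derivative[OF assms(2) moderate_C0_has_derivative[OF f]])
qed

lemma moderate_upto_add:
  assumes "open \<Omega>" "moderate_upto k \<Omega> f" "moderate_upto k \<Omega> h"
  shows "moderate_upto k \<Omega> (\<lambda>\<epsilon> x. f \<epsilon> x + h \<epsilon> x)"
  using assms(2,3)
proof (induction k arbitrary: f h rule: less_induct)
  case (less k)
  have f: "moderate_C0 \<Omega> f" and h: "moderate_C0 \<Omega> h"
    by (rule moderate_upto_imp_C0[OF less.prems(1)], rule moderate_upto_imp_C0[OF less.prems(2)])
  show ?case
  proof (rule moderate_uptoI[OF assms(1)])
    show "moderately_bounded \<Omega> (\<lambda>\<epsilon> x. f \<epsilon> x + h \<epsilon> x)"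
      using f h by (intro moderately_bounded_add) (auto simp: moderate_C0_def)
    show "moderate_upto j \<Omega> (\<lambda>\<epsilon> x. frechet_derivative (f \<epsilon>) (at x) b
        + frechet_derivative (h \<epsilon>) (at x) b)" if "j < k" "b \<in> Basis" for j b
      by (rule less.IH[OF that(1) moderate_upto_partial[OF less.prems(1) that]
            moderate_upto_partial[OF less.prems(2) that]])
  qed (intro has_derivative_add moderate_C0_has_derivative[OF f] moderate_C0_has_derivative[OF h])
qed

lemma moderate_upto_sum:
  assumes "open \<Omega>" "\<And>i. i \<in> I \<Longrightarrow> moderate_upto k \<Omega> (f i)"
  shows "moderate_upto k \<Omega> (\<lambda>\<epsilon> x. \<Sum>i\<in>I. f i \<epsilon> x)"
  using assms(2)
  by (induction I rule: infinite_finite_induct)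
    (simp_all add: moderate_upto_add[OF assms(1)] moderate_upto_const[OF assms(1)])

lemma moderate_upto_scaleR:
  assumes "open \<Omega>" "moderate_upto k \<Omega> f" "moderate_upto k \<Omega> h"
  shows "moderate_upto k \<Omega> (\<lambda>\<epsilon> x. f \<epsilon> x *\<^sub>R h \<epsilon> x)"
  using assms(2,3)
proof (induction k arbitrary: f h rule: less_induct)
  case (less k)
  have f: "moderate_C0 \<Omega> f" and h: "moderate_C0 \<Omega> h"
    by (rule moderate_upto_imp_C0[OF less.prems(1)], rule moderate_upto_imp_C0[OF less.prems(2)])
  show ?case
  proof (rule moderate_uptoI[OF assms(1)])
    show "moderately_bounded \<Omega> (\<lambda>\<epsilon> x. f \<epsilon> x *\<^sub>R h \<epsilon> x)"
      using f h by (intro moderately_bounded_scaleR) (auto simp: moderate_C0_def)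
    show "moderate_upto j \<Omega> (\<lambda>\<epsilon> x. f \<epsilon> x *\<^sub>R frechet_derivative (h \<epsilon>) (at x) b
        + frechet_derivative (f \<epsilon>) (at x) b *\<^sub>R h \<epsilon> x)" if "j < k" "b \<in> Basis" for j b
      by (rule moderate_upto_add[OF assms(1)]; rule less.IH[OF that(1)])
        (rule moderate_upto_partial[OF less.prems(1) that] moderate_upto_partial[OF less.prems(2) that]
          moderate_upto_mono[OF less.prems(1) less_imp_le[OF that(1)]]
          moderate_upto_mono[OF less.prems(2) less_imp_le[OF that(1)]])+
  qed (rule has_derivative_scaleR[OF moderate_C0_has_derivative[OF f] moderate_C0_has_derivative[OF h]])
qed

lemma moderate_add:
  assumes "open \<Omega>" "f \<in> moderate \<Omega>" "h \<in> moderate \<Omega>"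
  shows "(\<lambda>\<epsilon> x. f \<epsilon> x + h \<epsilon> x) \<in> moderate \<Omega>"
  using assms(2,3) unfolding moderate_iff_upto by (simp add: moderate_upto_add[OF assms(1)])

lemma moderate_sum:
  assumes "open \<Omega>" "\<And>i. i \<in> I \<Longrightarrow> f i \<in> moderate \<Omega>"
  shows "(\<lambda>\<epsilon> x. \<Sum>i\<in>I. f i \<epsilon> x) \<in> moderate \<Omega>"
  using assms(2) unfolding moderate_iff_upto by (simp add: moderate_upto_sum[OF assms(1)])

lemma moderate_linear:
  assumes "open \<Omega>" "bounded_linear T" "f \<in> moderate \<Omega>"
  shows "(\<lambda>\<epsilon> x. T (f \<epsilon> x)) \<in> moderate \<Omega>"
  unfolding moderate_iff_upto
  by (rule allI, rule moderate_upto_linear[OF assms(1,2)]) (use assms(3) moderate_iff_upto in blast)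

lemma moderate_const: "open \<Omega> \<Longrightarrow> (\<lambda>_ _. c) \<in> moderate \<Omega>"
  by (simp add: moderate_iff_upto moderate_upto_const)

lemma moderate_diff:
  assumes "open \<Omega>" "f \<in> moderate \<Omega>" "h \<in> moderate \<Omega>"
  shows "(\<lambda>\<epsilon> x. f \<epsilon> x - h \<epsilon> x) \<in> moderate \<Omega>"
proof -
  have "(\<lambda>\<epsilon> x. - h \<epsilon> x) \<in> moderate \<Omega>"
    by (rule moderate_linear[OF assms(1) bounded_linear_minus[OF bounded_linear_ident] assms(3)])
  from moderate_add[OF assms(1,2) this] show ?thesis by simp
qed

lemma moderate_ident: "open \<Omega> \<Longrightarrow> (\<lambda>_ x. x) \<in> moderate \<Omega>"
  unfolding moderate_iff_upto
  by (rule allI, rule moderate_uptoI[where f' = "\<lambda>_ _ v. v"])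
    (auto intro: moderately_bounded_continuous moderate_upto_const)

section \<open>Compositions\<close>

text \<open>
  Every derivative of \<open>F\<close> is of moderate growth at the values of \<open>w\<close>.  This covers two cases at once:
  \<open>F\<close> may be a slowly increasing function and \<open>w\<close> a moderate net, as well as \<open>F\<close> a
  moderate net and \<open>w\<close> a smooth map.
\<close>

definition moderate_along ::
    "'a::euclidean_space set \<Rightarrow> (real \<Rightarrow> 'a \<Rightarrow> 'b::euclidean_space) \<Rightarrow>
     (real \<Rightarrow> 'b \<Rightarrow> 'c::real_normed_vector) \<Rightarrow> bool" where
  "moderate_along \<Omega> w F \<longleftrightarrow> (\<forall>vs. set vs \<subseteq> Basis \<longrightarrow>
     (\<forall>\<epsilon>\<in>{0<..1}. \<forall>x\<in>\<Omega>. iter_partial vs (F \<epsilon>) differentiable (at (w \<epsilon> x))) \<and>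
     moderately_bounded \<Omega> (\<lambda>\<epsilon> x. iter_partial vs (F \<epsilon>) (w \<epsilon> x)))"

lemma moderate_along_net_partial:
  assumes "moderate_along \<Omega> w F" "b \<in> Basis"
  shows "moderate_along \<Omega> w (net_partial b F)"
  unfolding moderate_along_def
proof (intro allI impI)
  fix vs :: "'b list" assume "set vs \<subseteq> Basis"
  then show "(\<forall>\<epsilon>\<in>{0<..1}. \<forall>x\<in>\<Omega>. iter_partial vs (net_partial b F \<epsilon>) differentiable (at (w \<epsilon> x))) \<and>
     moderately_bounded \<Omega> (\<lambda>\<epsilon> x. iter_partial vs (net_partial b F \<epsilon>) (w \<epsilon> x))"
    using assms(1)[unfolded moderate_along_def, rule_format, of "b # vs"] assms(2) by simp
qed

text \<open>
  By the chain rule the partial derivative of \<open>F \<circ> w\<close> in direction \<open>v\<close> is the sum of the products of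
  \<open>\<partial>\<^sub>v (w \<bullet> b)\<close> and \<open>\<partial>\<^sub>b F \<circ> w\<close>.  The second factors are compositions of the same kind, because \<open>\<partial>\<^sub>b F\<close>
  inherits the hypothesis on \<open>F\<close>, so the induction hypothesis applies to them.
\<close>

lemma moderate_upto_compose:
  assumes "open \<Omega>" "w \<in> moderate \<Omega>" "moderate_along \<Omega> w F"
  shows "moderate_upto k \<Omega> (\<lambda>\<epsilon> x. F \<epsilon> (w \<epsilon> x))"
  using assms(3)
proof (induction k arbitrary: F rule: less_induct)
  case (less k)
  have w: "moderate_C0 \<Omega> w" using assms(2) unfolding moderate_iff_upto by (meson moderate_upto_imp_C0)
  have F: "F \<epsilon> differentiable (at (w \<epsilon> x))" if "\<epsilon> \<in> {0<..1}" "x \<in> \<Omega>" for \<epsilon> x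
    using less.prems[unfolded moderate_along_def, rule_format, of "[]"] that by auto
  show ?case
  proof (rule moderate_uptoI[OF assms(1)])
    show "moderately_bounded \<Omega> (\<lambda>\<epsilon> x. F \<epsilon> (w \<epsilon> x))"
      using less.prems[unfolded moderate_along_def, rule_format, of "[]"] by auto
    show "((\<lambda>x. F \<epsilon> (w \<epsilon> x)) has_derivative
      (\<lambda>v. \<Sum>b\<in>Basis. (frechet_derivative (w \<epsilon>) (at x) v \<bullet> b) *\<^sub>R net_partial b F \<epsilon> (w \<epsilon> x))) (at x)"
      if "\<epsilon> \<in> {0<..1}" "x \<in> \<Omega>" for \<epsilon> x
      using diff_chain_at[OF moderate_C0_has_derivative[OF w that] F[OF that, unfolded frechet_derivative_works]]
      by (simp add: o_def frechet_derivative_eq_sum_Basis[OF F[OF that], symmetric])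
    show "moderate_upto j \<Omega> (\<lambda>\<epsilon> x. \<Sum>b\<in>Basis.
        (frechet_derivative (w \<epsilon>) (at x) v \<bullet> b) *\<^sub>R net_partial b F \<epsilon> (w \<epsilon> x))"
      if "j < k" "v \<in> Basis" for j v
    proof -
      have "moderate_upto j \<Omega> (net_partial v w)"
        using moderate_net_partial[OF assms(2) that(2)] moderate_iff_upto by blast
      then show ?thesis
        by (intro moderate_upto_sum[OF assms(1)] moderate_upto_scaleR[OF assms(1)]
            moderate_upto_linear[OF assms(1) bounded_linear_inner_left]
            less.IH[OF that(1) moderate_along_net_partial[OF less.prems]])
    qed
  qed
qed

lemma moderate_compose:
  assumes "open \<Omega>" "w \<in> moderate \<Omega>" "moderate_along \<Omega> w F"
  shows "(\<lambda>\<epsilon> x. F \<epsilon> (w \<epsilon> x)) \<in> moderate \<Omega>"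
  using moderate_upto_compose[OF assms] moderate_iff_upto by blast

text \<open>
  A smooth function is a net that does not depend on \<open>\<epsilon>\<close>.  This makes closure properties of smooth
  functions special cases of those of moderate nets.
\<close>

lemma moderate_of_smooth:
  assumes "open \<Omega>" "smooth_on \<Omega> f"
  shows "(\<lambda>_. f) \<in> moderate \<Omega>"
  unfolding moderate_iff_iter_partial moderate_C0_def
proof (intro allI impI conjI)
  fix vs :: "'a list" assume vs: "set vs \<subseteq> Basis"
  then show "\<forall>\<epsilon>\<in>{0<..1}. \<forall>x\<in>\<Omega>. iter_partial vs f differentiable (at x)"
    using assms(2) by (auto simp: smooth_on_def)
  show "moderately_bounded \<Omega> (\<lambda>\<epsilon>. iter_partial vs f)"
    by (rule moderately_bounded_continuous
        [OF smooth_on_imp_continuous_on[OF smooth_on_iter_partial[OF assms(2) vs]]])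
qed

lemma smooth_on_compose:
  assumes "open \<Omega>" "smooth_on \<Omega> w" "smooth_on S F" "w ` \<Omega> \<subseteq> S"
  shows "smooth_on \<Omega> (\<lambda>x. F (w x))"
proof -
  have "(\<lambda>_ x. F (w x)) \<in> moderate \<Omega>"
  proof (rule moderate_compose[OF assms(1) moderate_of_smooth[OF assms(1,2)]])
    have d: "iter_partial vs F differentiable (at (w x))" if "set vs \<subseteq> Basis" "x \<in> \<Omega>" for vs x
      using assms(3,4) that by (auto simp: smooth_on_def)
    have "continuous_on \<Omega> (\<lambda>x. iter_partial vs F (w x))" if "set vs \<subseteq> Basis" for vs
      by (rule continuous_on_compose2[OF smooth_on_imp_continuous_on
            [OF smooth_on_iter_partial[OF assms(3) that]] smooth_on_imp_continuous_on[OF assms(2)] assms(4)])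
    then show "moderate_along \<Omega> (\<lambda>_. w) (\<lambda>_. F)"
      using d by (auto simp: moderate_along_def intro!: moderately_bounded_continuous)
  qed
  from moderate_imp_smooth[OF this, of 1] show ?thesis by simp
qed

lemma moderate_compose_smooth:
  assumes "open \<Omega>'" "smooth_on \<Omega>' \<psi>" "\<psi> ` \<Omega>' \<subseteq> \<Omega>" "u \<in> moderate \<Omega>"
  shows "(\<lambda>\<epsilon> y. u \<epsilon> (\<psi> y)) \<in> moderate \<Omega>'"
proof (rule moderate_compose[OF assms(1) moderate_of_smooth[OF assms(1,2)]])
  have \<psi>: "continuous_on \<Omega>' \<psi>" by (rule smooth_on_imp_continuous_on[OF assms(2)])
  have u: "(\<lambda>\<epsilon>. iter_partial vs (u \<epsilon>)) \<in> moderate \<Omega>" if "set vs \<subseteq> Basis" for vs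
    using moderate_iter_partial[OF assms(4) that] .
  show "moderate_along \<Omega>' (\<lambda>_. \<psi>) u"
    unfolding moderate_along_def
    using moderately_bounded_compose[OF moderate_moderately_bounded[OF u] \<psi> assms(3)]
      moderate_differentiable[OF u] assms(3) by blast
qed

section \<open>Negligible nets and classes\<close>

text \<open>
  Solve the Taylor formula of order one for the first derivative.  The increment \<open>t\<close> is free, and this is
  what is exploited below: small values of \<open>f\<close> force a small derivative if the second one is controlled.
\<close>

lemma norm_derivative_le_values_and_second_derivative:
  fixes f :: "'a::real_normed_vector \<Rightarrow> 'b::real_normed_vector"
  assumes "t > 0"
    and f': "\<And>s. s \<in> {0..t} \<Longrightarrow> ((\<lambda>s. f (x + s *\<^sub>R b)) has_vector_derivative f' (x + s *\<^sub>R b)) (at s)"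
    and f'': "\<And>s. s \<in> {0..t} \<Longrightarrow> ((\<lambda>s. f' (x + s *\<^sub>R b)) has_vector_derivative f'' (x + s *\<^sub>R b)) (at s)"
    and B: "\<And>s. s \<in> {0..t} \<Longrightarrow> norm (f'' (x + s *\<^sub>R b)) \<le> B"
  shows "norm (f' x) \<le> (norm (f (x + t *\<^sub>R b)) + norm (f x)) / t + t * B"
proof -
  have "norm (f' (x + s *\<^sub>R b) - f' (x + 0 *\<^sub>R b)) \<le> B * norm (s - 0)" if s: "s \<in> {0..t}" for s
  proof (rule differentiable_bound[where S = "{0..t}" and f' = "\<lambda>s h. h *\<^sub>R f'' (x + s *\<^sub>R b)"])
    show "((\<lambda>s. f' (x + s *\<^sub>R b)) has_derivative (\<lambda>h. h *\<^sub>R f'' (x + r *\<^sub>R b))) (at r within {0..t})"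
      if "r \<in> {0..t}" for r
      using f''[OF that] unfolding has_vector_derivative_def by (rule has_derivative_at_withinI)
    show "onorm (\<lambda>h. h *\<^sub>R f'' (x + r *\<^sub>R b)) \<le> B" if "r \<in> {0..t}" for r
      using B[OF that] by (intro onorm_le) (simp add: mult.commute[of B] mult_left_mono)
  qed (use s assms(1) in auto)
  moreover have "B \<ge> 0" using order_trans[OF norm_ge_zero B[of 0]] assms(1) by simp
  ultimately have lip: "norm (f' (x + s *\<^sub>R b) - f' (x + 0 *\<^sub>R b)) \<le> t * B" if "s \<in> {0..t}" for s
    using that by (smt (verit) atLeastAtMost_iff mult.commute mult_right_mono real_norm_def)
  have "norm (f (x + t *\<^sub>R b) - f (x + 0 *\<^sub>R b) - (t - 0) *\<^sub>R f' (x + 0 *\<^sub>R b)) \<le> norm (t - 0) * (t * B)"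
    by (rule vector_differentiable_bound_linearization[where S = "{0..t}" and f' = "\<lambda>s. f' (x + s *\<^sub>R b)"])
      (use f' lip assms(1) in \<open>auto intro: has_vector_derivative_at_within simp: closed_segment_eq_real_ivl\<close>)
  then have "norm (f (x + t *\<^sub>R b) - f x - t *\<^sub>R f' x) \<le> t * (t * B)"
    using assms(1) by simp
  moreover have "norm (t *\<^sub>R f' x) \<le> norm (f (x + t *\<^sub>R b) - f x) + norm (f (x + t *\<^sub>R b) - f x - t *\<^sub>R f' x)"
    by (metis add.commute diff_add_cancel norm_minus_commute norm_triangle_sub)
  moreover have "norm (f (x + t *\<^sub>R b) - f x) \<le> norm (f (x + t *\<^sub>R b)) + norm (f x)"
    by (rule norm_triangle_ineq4)
  ultimately have "t * norm (f' x) \<le> norm (f (x + t *\<^sub>R b)) + norm (f x) + t * (t * B)"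
    using assms(1) by simp
  then show ?thesis
    using assms(1) by (simp add: field_simps)
qed

lemma compact_cball_neighbourhood:
  fixes K :: "'a::euclidean_space set"
  assumes "compact K" "open \<Omega>" "K \<subseteq> \<Omega>"
  obtains \<delta> where "\<delta> > 0" "compact (\<Union>x\<in>K. cball x \<delta>)" "(\<Union>x\<in>K. cball x \<delta>) \<subseteq> \<Omega>"
proof -
  obtain \<delta> where \<delta>: "\<delta> > 0" "(\<Union>x\<in>K. cball x \<delta>) \<subseteq> \<Omega>"
    using compact_subset_open_imp_cball_epsilon_subset[OF assms] by blast
  have "(\<Union>x\<in>K. cball x \<delta>) = {x + y | x y. x \<in> K \<and> y \<in> cball 0 \<delta>}"
  proof (intro set_eqI iffI)
    fix z assume "z \<in> (\<Union>x\<in>K. cball x \<delta>)"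
    then obtain x where "x \<in> K" "dist x z \<le> \<delta>" by auto
    then show "z \<in> {x + y | x y. x \<in> K \<and> y \<in> cball 0 \<delta>}"
      by (intro CollectI exI[of _ x] exI[of _ "z - x"]) (auto simp: dist_norm norm_minus_commute)
  qed (force simp: dist_norm)
  then have "compact (\<Union>x\<in>K. cball x \<delta>)"
    using compact_sums[OF assms(1), of "cball 0 \<delta>"] by simp
  with \<delta> show ?thesis using that by blast
qed

text \<open>
  Choose the increment in the previous estimate to be a power of \<open>\<epsilon>\<close> that is high enough to beat the
  moderate second derivative; the values of \<open>f\<close> are negligible, hence small even compared with it.
\<close>

lemma negligibly_bounded_net_partial:
  fixes f :: "real \<Rightarrow> 'a::euclidean_space \<Rightarrow> 'b::real_normed_vector"
  assumes "open \<Omega>" "f \<in> moderate \<Omega>" "negligibly_bounded \<Omega> f" and b: "b \<in> Basis"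
  shows "negligibly_bounded \<Omega> (net_partial b f)"
  unfolding negligibly_bounded_def
proof (intro allI impI; elim conjE)
  fix K and m :: nat assume K: "compact K" "K \<subseteq> \<Omega>"
  obtain \<delta> where \<delta>: "\<delta> > 0" and L: "compact (\<Union>x\<in>K. cball x \<delta>)" "(\<Union>x\<in>K. cball x \<delta>) \<subseteq> \<Omega>"
    using compact_cball_neighbourhood[OF K(1) assms(1) K(2)] .
  let ?L = "\<Union>x\<in>K. cball x \<delta>"
  have f1: "net_partial b f \<in> moderate \<Omega>" and f2: "net_partial b (net_partial b f) \<in> moderate \<Omega>"
    using moderate_net_partial assms(2) b by blast+
  obtain n A where A: "A \<ge> 0"
    "\<forall>\<^sub>F \<epsilon> in at_right 0. \<forall>x\<in>?L. norm (net_partial b (net_partial b f) \<epsilon> x) \<le> A * (1 / \<epsilon>) ^ n"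
    using moderately_boundedE[OF moderate_moderately_bounded[OF f2] L] by blast
  \<comment> \<open>The increment \<open>\<epsilon>^(k + 1)\<close> turns the second order term \<open>\<epsilon>^(k + 1) * \<epsilon>^(-n)\<close> into \<open>\<epsilon>^(m + 1)\<close>; the order
    \<open>m + k + 1\<close> for the values of \<open>f\<close> pays for the division by the increment.\<close>
  define k where "k = m + n"
  obtain C where C: "C \<ge> 0"
    "\<forall>\<^sub>F \<epsilon> in at_right 0. \<forall>x\<in>?L. norm (f \<epsilon> x) \<le> C * \<epsilon> ^ (m + Suc k)"
    using negligibly_boundedE[OF assms(3) L] by blast
  have der: "((\<lambda>s. h \<epsilon> (x + s *\<^sub>R b)) has_vector_derivative net_partial b h \<epsilon> (x + s *\<^sub>R b)) (at s)"
    if "h \<in> moderate \<Omega>" "\<epsilon> \<in> {0<..1}" "x + s *\<^sub>R b \<in> \<Omega>" for h :: "real \<Rightarrow> 'a \<Rightarrow> 'b" and \<epsilon> x s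
  proof -
    have h: "(h \<epsilon> has_derivative frechet_derivative (h \<epsilon>) (at (x + s *\<^sub>R b))) (at (x + s *\<^sub>R b))"
      using moderate_differentiable[OF that] frechet_derivative_works by blast
    have "((\<lambda>s. h \<epsilon> (x + s *\<^sub>R b)) has_derivative
        (\<lambda>r. frechet_derivative (h \<epsilon>) (at (x + s *\<^sub>R b)) (r *\<^sub>R b))) (at s)"
    proof -
      have "((\<lambda>s. x + s *\<^sub>R b) has_derivative (\<lambda>r. r *\<^sub>R b)) (at s)"
        by (auto intro!: derivative_eq_intros)
      from diff_chain_at[OF this h] show ?thesis by (simp add: o_def)
    qed
    moreover have "frechet_derivative (h \<epsilon>) (at (x + s *\<^sub>R b)) (r *\<^sub>R b)
        = r *\<^sub>R net_partial b h \<epsilon> (x + s *\<^sub>R b)" for r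
      using linear_frechet_derivative[OF moderate_differentiable[OF that]] by (rule linear_cmul)
    ultimately show ?thesis by (simp add: has_vector_derivative_def)
  qed
  have small: "\<forall>\<^sub>F \<epsilon> in at_right 0. \<epsilon> \<le> \<delta>"
    unfolding eventually_at_right_field using \<delta> by (intro exI[of _ \<delta>]) auto
  have "\<forall>\<^sub>F \<epsilon> in at_right 0. \<forall>x\<in>K. norm (net_partial b f \<epsilon> x) \<le> (2 * C + A) * \<epsilon> ^ m"
    using A(2) C(2) eventually_in_index_set small
  proof eventually_elim
    case (elim \<epsilon>)
    show ?case
    proof
      fix x assume x: "x \<in> K"
      define t where "t = \<epsilon> ^ Suc k"
      have t: "0 < t" using elim by (simp add: t_def)
      have "t \<le> \<epsilon> ^ 1" unfolding t_def using elim by (intro power_decreasing) auto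
      then have "t \<le> \<delta>" using elim by simp
      then have seg: "x + s *\<^sub>R b \<in> ?L" if "s \<in> {0..t}" for s
        using that x b by (intro UN_I[OF x]) (auto simp: dist_norm)
      have "norm (net_partial b f \<epsilon> x)
          \<le> (norm (f \<epsilon> (x + t *\<^sub>R b)) + norm (f \<epsilon> x)) / t + t * (A * (1 / \<epsilon>) ^ n)"
      proof (rule norm_derivative_le_values_and_second_derivative[OF t])
        fix s assume s: "s \<in> {0..t}"
        show "((\<lambda>s. f \<epsilon> (x + s *\<^sub>R b)) has_vector_derivative net_partial b f \<epsilon> (x + s *\<^sub>R b)) (at s)"
          by (rule der[OF assms(2) elim(3) subsetD[OF L(2) seg[OF s]]])
        show "((\<lambda>s. net_partial b f \<epsilon> (x + s *\<^sub>R b)) has_vector_derivative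
            net_partial b (net_partial b f) \<epsilon> (x + s *\<^sub>R b)) (at s)"
          by (rule der[OF f1 elim(3) subsetD[OF L(2) seg[OF s]]])
        show "norm (net_partial b (net_partial b f) \<epsilon> (x + s *\<^sub>R b)) \<le> A * (1 / \<epsilon>) ^ n"
          by (rule bspec[OF elim(1) seg[OF s]])
      qed
      also have "\<dots> \<le> (C * \<epsilon> ^ (m + Suc k) + C * \<epsilon> ^ (m + Suc k)) / t + t * (A * (1 / \<epsilon>) ^ n)"
        using elim(2) seg[of t] seg[of 0] t by (intro add_mono divide_right_mono) auto
      also have "\<dots> = 2 * C * \<epsilon> ^ m + A * (\<epsilon> ^ m * \<epsilon>)"
        using elim by (simp add: t_def k_def power_add power_divide field_simps)
      also have "\<dots> \<le> 2 * C * \<epsilon> ^ m + A * (\<epsilon> ^ m * 1)"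
        using elim A(1) by (intro add_left_mono mult_left_mono) auto
      finally show "norm (net_partial b f \<epsilon> x) \<le> (2 * C + A) * \<epsilon> ^ m"
        by (simp add: algebra_simps)
    qed
  qed
  then show "\<exists>C. \<forall>\<^sub>F \<epsilon> in at_right 0. \<forall>x\<in>K. norm (net_partial b f \<epsilon> x) \<le> C * \<epsilon> ^ m" by blast
qed

lemma negligibly_bounded_iter_partial:
  assumes "open \<Omega>" "f \<in> moderate \<Omega>" "negligibly_bounded \<Omega> f" "set vs \<subseteq> Basis"
  shows "negligibly_bounded \<Omega> (\<lambda>\<epsilon>. iter_partial vs (f \<epsilon>))"
  using assms(2-)
proof (induction vs arbitrary: f)
  case (Cons b vs)
  then show ?case
    using Cons.IH[of "net_partial b f"] moderate_net_partial[of f \<Omega> b]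
      negligibly_bounded_net_partial[OF assms(1), of f b] by simp
qed simp

text \<open>
  For moderate nets negligibility is a condition on the values only, by iterating the previous estimate.
  This reduces equality of classes to zeroth order bounds.
\<close>

lemma negligible_nets_iff:
  assumes "open \<Omega>"
  shows "f \<in> negligible_nets \<Omega> \<longleftrightarrow> f \<in> moderate \<Omega> \<and> negligibly_bounded \<Omega> f"
proof
  assume f: "f \<in> negligible_nets \<Omega>"
  then have "\<exists>C. \<forall>\<^sub>F \<epsilon> in at_right 0. \<forall>x\<in>K. norm (f \<epsilon> x) \<le> C * \<epsilon> ^ m"
    if "compact K" "K \<subseteq> \<Omega>" for K m
    using f[unfolded negligible_nets_def mem_Collect_eq, THEN conjunct2, rule_format, of K "[]" m] that
    by simp
  then show "f \<in> moderate \<Omega> \<and> negligibly_bounded \<Omega> f"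
    using f by (simp add: negligible_nets_def negligibly_bounded_def)
next
  assume "f \<in> moderate \<Omega> \<and> negligibly_bounded \<Omega> f"
  then show "f \<in> negligible_nets \<Omega>"
    using negligibly_bounded_iter_partial[OF assms, of f]
    by (simp add: negligible_nets_def negligibly_bounded_def)
qed

lemma colombeau_rel_iff:
  assumes "open \<Omega>"
  shows "(u, v) \<in> colombeau_rel \<Omega> \<longleftrightarrow>
      u \<in> moderate \<Omega> \<and> v \<in> moderate \<Omega> \<and> negligibly_bounded \<Omega> (\<lambda>\<epsilon> x. u \<epsilon> x - v \<epsilon> x)"
  using moderate_diff[OF assms] by (auto simp: colombeau_rel_def negligible_nets_iff[OF assms])

lemma equiv_colombeau_rel:
  assumes "open \<Omega>"
  shows "equiv (moderate \<Omega>) (colombeau_rel \<Omega> :: (real \<Rightarrow> 'a::euclidean_space \<Rightarrow> 'b::real_normed_vector) rel)"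
proof (rule equivI)
  have zero: "negligibly_bounded \<Omega> (\<lambda>_ _. 0 :: 'b)"
    unfolding negligibly_bounded_def by (intro allI impI exI[of _ 0]) simp
  show "colombeau_rel \<Omega> \<subseteq> moderate \<Omega> \<times> (moderate \<Omega> :: (real \<Rightarrow> 'a \<Rightarrow> 'b) set)"
    by (auto simp: colombeau_rel_def)
  show "refl_on (moderate \<Omega>) (colombeau_rel \<Omega> :: (real \<Rightarrow> 'a \<Rightarrow> 'b) rel)"
    using zero by (auto simp: refl_on_def colombeau_rel_iff[OF assms])
  show "sym (colombeau_rel \<Omega> :: (real \<Rightarrow> 'a \<Rightarrow> 'b) rel)"
  proof (rule symI)
    fix u v :: "real \<Rightarrow> 'a \<Rightarrow> 'b" assume "(u, v) \<in> colombeau_rel \<Omega>"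
    then show "(v, u) \<in> colombeau_rel \<Omega>"
      unfolding colombeau_rel_iff[OF assms]
      using negligibly_bounded_minus[of \<Omega> "\<lambda>\<epsilon> x. u \<epsilon> x - v \<epsilon> x"] by simp
  qed
  show "trans (colombeau_rel \<Omega> :: (real \<Rightarrow> 'a \<Rightarrow> 'b) rel)"
  proof (rule transI)
    fix u v w :: "real \<Rightarrow> 'a \<Rightarrow> 'b" assume "(u, v) \<in> colombeau_rel \<Omega>" "(v, w) \<in> colombeau_rel \<Omega>"
    then show "(u, w) \<in> colombeau_rel \<Omega>"
      unfolding colombeau_rel_iff[OF assms]
      using negligibly_bounded_add[of \<Omega> "\<lambda>\<epsilon> x. u \<epsilon> x - v \<epsilon> x" "\<lambda>\<epsilon> x. v \<epsilon> x - w \<epsilon> x"] by simp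
  qed
qed

lemma cl_eq_zero_iff:
  fixes u :: "real \<Rightarrow> 'a::euclidean_space \<Rightarrow> 'b::real_normed_vector"
  assumes "open \<Omega>" "u \<in> moderate \<Omega>"
  shows "cl \<Omega> u = cl \<Omega> (\<lambda>_ _. 0) \<longleftrightarrow> negligibly_bounded \<Omega> u"
proof -
  have zero: "(\<lambda>_ _. 0 :: 'b) \<in> moderate \<Omega>" by (rule moderate_const[OF assms(1)])
  show ?thesis
    unfolding cl_def eq_equiv_class_iff[OF equiv_colombeau_rel[OF assms(1)] assms(2) zero]
    using assms(2) zero by (simp add: colombeau_rel_iff[OF assms(1)])
qed

text \<open>
  The common pattern of the two operations on classes, inserting into a differential expression and
  acting by a transformation: a map of nets that respects negligible differences can be evaluated on
  any representative.
\<close>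

lemma UN_cl_eq:
  fixes T :: "(real \<Rightarrow> 'a::euclidean_space \<Rightarrow> 'b::real_normed_vector) \<Rightarrow>
    real \<Rightarrow> 'c::euclidean_space \<Rightarrow> 'd::real_normed_vector"
  assumes "open \<Omega>" "open \<Omega>'" "u \<in> moderate \<Omega>"
    and T: "\<And>u. u \<in> moderate \<Omega> \<Longrightarrow> T u \<in> moderate \<Omega>'"
    and diff: "\<And>u v. u \<in> moderate \<Omega> \<Longrightarrow> v \<in> moderate \<Omega> \<Longrightarrow>
      (\<lambda>\<epsilon> x. u \<epsilon> x - v \<epsilon> x) \<in> negligible_nets \<Omega> \<Longrightarrow>
      negligibly_bounded \<Omega>' (\<lambda>\<epsilon> x. T u \<epsilon> x - T v \<epsilon> x)"
  shows "(\<Union>u\<in>cl \<Omega> u. cl \<Omega>' (T u)) = cl \<Omega>' (T u)"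
  unfolding cl_def
proof (rule UN_equiv_class[OF equiv_colombeau_rel[OF assms(1)] _ assms(3)])
  show "(\<lambda>u. colombeau_rel \<Omega>' `` {T u}) respects colombeau_rel \<Omega>"
  proof (rule congruentI)
    fix u v :: "real \<Rightarrow> 'a \<Rightarrow> 'b" assume "(u, v) \<in> colombeau_rel \<Omega>"
    then have "(T u, T v) \<in> colombeau_rel \<Omega>'"
      using T[of u] T[of v] diff[of u v]
      by (simp add: colombeau_rel_iff[OF assms(2)]) (simp add: colombeau_rel_def)
    then show "colombeau_rel \<Omega>' `` {T u} = colombeau_rel \<Omega>' `` {T v}"
      by (rule equiv_class_eq[OF equiv_colombeau_rel[OF assms(2)]])
  qed
qed

section \<open>Slowly increasing functions of nets\<close>

lemma moderate_along_polynomial: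
  assumes w: "w \<in> moderate \<Omega>" "\<And>\<epsilon> x. \<epsilon> \<in> {0<..1} \<Longrightarrow> x \<in> \<Omega> \<Longrightarrow> w \<epsilon> x \<in> S"
    and F: "smooth_on S F"
      "\<And>K vs. compact K \<Longrightarrow> K \<subseteq> \<Omega> \<Longrightarrow> set vs \<subseteq> Basis \<Longrightarrow>
         \<exists>C (m::nat). \<forall>\<epsilon>\<in>{0<..1}. \<forall>x\<in>K.
           norm (iter_partial vs F (w \<epsilon> x)) \<le> C * (1 + norm (w \<epsilon> x)) ^ m"
  shows "moderate_along \<Omega> w (\<lambda>_. F)"
  unfolding moderate_along_def
proof (intro allI impI conjI)
  fix vs :: "'b list" assume vs: "set vs \<subseteq> Basis"
  show "\<forall>\<epsilon>\<in>{0<..1}. \<forall>x\<in>\<Omega>. iter_partial vs F differentiable at (w \<epsilon> x)"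
    using F(1) vs w(2) by (auto simp: smooth_on_def)
  show "moderately_bounded \<Omega> (\<lambda>\<epsilon> x. iter_partial vs F (w \<epsilon> x))"
  proof (rule moderately_bounded_polynomial[OF moderate_moderately_bounded[OF w(1)]])
    fix K assume K: "compact K" "K \<subseteq> \<Omega>"
    obtain C and m :: nat where *: "\<forall>\<epsilon>\<in>{0<..1}. \<forall>x\<in>K.
        norm (iter_partial vs F (w \<epsilon> x)) \<le> C * (1 + norm (w \<epsilon> x)) ^ m"
      using F(2)[OF K vs] by (elim exE)
    have **: "norm (iter_partial vs F (w \<epsilon> x)) \<le> \<bar>C\<bar> * (1 + norm (w \<epsilon> x)) ^ m"
      if "\<epsilon> \<in> {0<..1}" "x \<in> K" for \<epsilon> x
    proof -
      have "C * (1 + norm (w \<epsilon> x)) ^ m \<le> \<bar>C\<bar> * (1 + norm (w \<epsilon> x)) ^ m"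
        by (intro mult_right_mono) auto
      with bspec[OF bspec[OF * that(1)] that(2)] show ?thesis by linarith
    qed
    show "\<exists>C\<ge>0. \<exists>k. \<forall>\<epsilon>\<in>{0<..1}. \<forall>x\<in>K.
        norm (iter_partial vs F (w \<epsilon> x)) \<le> C * (1 + norm (w \<epsilon> x)) ^ k"
      by (intro exI[of _ "\<bar>C\<bar>"] exI[of _ m] conjI ballI **) auto
  qed
qed

text \<open>
  The mean value inequality, with the operator norm estimated through the partial derivatives.
\<close>

lemma norm_diff_le_partials:
  fixes F :: "'a::euclidean_space \<Rightarrow> 'b::real_normed_vector"
  assumes "closed_segment y z \<subseteq> S" "smooth_on S F"
    and B: "\<And>b p. b \<in> Basis \<Longrightarrow> p \<in> closed_segment y z \<Longrightarrow> norm (frechet_derivative F (at p) b) \<le> B"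
  shows "norm (F y - F z) \<le> (real DIM('a) * B) * norm (y - z)"
proof (rule differentiable_bound[where S = "closed_segment y z" and f' = "\<lambda>p. frechet_derivative F (at p)"])
  have d: "F differentiable (at p)" if "p \<in> closed_segment y z" for p
    using assms(2)[unfolded smooth_on_def, rule_format, of "[]"] assms(1) that by auto
  show "(F has_derivative frechet_derivative F (at p)) (at p within closed_segment y z)"
    if "p \<in> closed_segment y z" for p
    using d[OF that] frechet_derivative_works has_derivative_at_withinI by blast
  show "onorm (frechet_derivative F (at p)) \<le> real DIM('a) * B" if p: "p \<in> closed_segment y z" for p
  proof (rule onorm_le)
    fix v
    have "norm (frechet_derivative F (at p) v) = norm (\<Sum>b\<in>Basis. (v \<bullet> b) *\<^sub>R frechet_derivative F (at p) b)"
      by (rule arg_cong[where f = norm, OF frechet_derivative_eq_sum_Basis[OF d[OF p]]])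
    also have "\<dots> \<le> (\<Sum>b\<in>(Basis::'a set). norm v * B)"
      by (intro sum_norm_le) (auto intro!: mult_mono B p Basis_le_norm)
    finally show "norm (frechet_derivative F (at p) v) \<le> (real DIM('a) * B) * norm v"
      by (simp add: mult_ac)
  qed
qed auto

text \<open>
  Since the points of the segment are bounded by \<open>norm w + norm w'\<close>, the derivative of a slowly increasing
  function is moderate on it.
\<close>

lemma negligibly_bounded_diff_compose:
  fixes w w' :: "real \<Rightarrow> 'a::euclidean_space \<Rightarrow> 'b::euclidean_space"
    and F :: "'b \<Rightarrow> 'c::real_normed_vector"
  assumes w: "moderately_bounded \<Omega> w" "moderately_bounded \<Omega> w'"
    and neg: "negligibly_bounded \<Omega> (\<lambda>\<epsilon> x. w \<epsilon> x - w' \<epsilon> x)"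
    and S: "\<And>\<epsilon> x. \<epsilon> \<in> {0<..1} \<Longrightarrow> x \<in> \<Omega> \<Longrightarrow> closed_segment (w \<epsilon> x) (w' \<epsilon> x) \<subseteq> S"
    and F: "smooth_on S F"
      "\<And>K b. compact K \<Longrightarrow> K \<subseteq> \<Omega> \<Longrightarrow> b \<in> Basis \<Longrightarrow>
         \<exists>C (m::nat). \<forall>\<epsilon>\<in>{0<..1}. \<forall>x\<in>K. \<forall>p\<in>closed_segment (w \<epsilon> x) (w' \<epsilon> x).
           norm (frechet_derivative F (at p) b) \<le> C * (1 + norm p) ^ m"
  shows "negligibly_bounded \<Omega> (\<lambda>\<epsilon> x. F (w \<epsilon> x) - F (w' \<epsilon> x))"
proof -
  \<comment> \<open>The difference quotient is moderate by the mean value theorem; where \<open>w = w'\<close> it is \<open>0\<close>, which is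
    harmless because the difference vanishes there too.\<close>
  define h :: "real \<Rightarrow> 'a \<Rightarrow> real" where
    "h \<epsilon> x = norm (F (w \<epsilon> x) - F (w' \<epsilon> x)) / norm (w \<epsilon> x - w' \<epsilon> x)" for \<epsilon> x
  have "moderately_bounded \<Omega> (\<lambda>\<epsilon> x. norm (w \<epsilon> x) + norm (w' \<epsilon> x))"
    by (rule moderately_bounded_add) (use w in \<open>auto simp: moderately_bounded_def\<close>)
  then have "moderately_bounded \<Omega> h"
  proof (rule moderately_bounded_polynomial)
    fix K assume K: "compact K" "K \<subseteq> \<Omega>"
    obtain C m where C: "\<And>b \<epsilon> x p. b \<in> Basis \<Longrightarrow> \<epsilon> \<in> {0<..1} \<Longrightarrow> x \<in> K \<Longrightarrow>
        p \<in> closed_segment (w \<epsilon> x) (w' \<epsilon> x) \<Longrightarrow>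
        norm (frechet_derivative F (at p) b) \<le> C b * (1 + norm p) ^ m b"
      using F(2)[OF K] by metis
    define A where "A = (\<Sum>b\<in>Basis. \<bar>C b\<bar>)"
    define n where "n = (\<Sum>b\<in>Basis. m b)"
    have h: "norm (h \<epsilon> x) \<le> (DIM('b) * A) * (1 + norm (norm (w \<epsilon> x) + norm (w' \<epsilon> x))) ^ n"
      if \<epsilon>: "\<epsilon> \<in> {0<..1}" and x: "x \<in> K" for \<epsilon> x
    proof -
      have "norm (frechet_derivative F (at p) b) \<le> A * (1 + norm (norm (w \<epsilon> x) + norm (w' \<epsilon> x))) ^ n"
        if b: "b \<in> Basis" and p: "p \<in> closed_segment (w \<epsilon> x) (w' \<epsilon> x)" for b p
      proof -
        obtain t where t: "0 \<le> t" "t \<le> 1" "p = (1 - t) *\<^sub>R w \<epsilon> x + t *\<^sub>R w' \<epsilon> x"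
          using p by (auto simp: in_segment)
        have "norm p \<le> (1 - t) * norm (w \<epsilon> x) + t * norm (w' \<epsilon> x)"
          unfolding t(3) using t(1,2) norm_triangle_ineq[of "(1 - t) *\<^sub>R w \<epsilon> x" "t *\<^sub>R w' \<epsilon> x"] by simp
        also have "\<dots> \<le> 1 * norm (w \<epsilon> x) + 1 * norm (w' \<epsilon> x)"
          using t(1,2) by (intro add_mono mult_right_mono) auto
        finally have le: "1 + norm p \<le> 1 + norm (norm (w \<epsilon> x) + norm (w' \<epsilon> x))" by simp
        have "\<bar>C b\<bar> \<le> A" unfolding A_def by (rule member_le_sum[OF b]) auto
        moreover have "m b \<le> n" unfolding n_def by (rule member_le_sum[OF b]) auto
        have "(1 + norm p) ^ m b \<le> (1 + norm (norm (w \<epsilon> x) + norm (w' \<epsilon> x))) ^ m b"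
          by (rule power_mono[OF le]) simp
        moreover have "\<dots> \<le> (1 + norm (norm (w \<epsilon> x) + norm (w' \<epsilon> x))) ^ n"
          by (rule power_increasing[OF \<open>m b \<le> n\<close>]) simp
        ultimately have "\<bar>C b\<bar> * (1 + norm p) ^ m b \<le> A * (1 + norm (norm (w \<epsilon> x) + norm (w' \<epsilon> x))) ^ n"
          by (intro mult_mono) auto
        moreover have "C b * (1 + norm p) ^ m b \<le> \<bar>C b\<bar> * (1 + norm p) ^ m b"
          by (intro mult_right_mono) auto
        ultimately show ?thesis using C[OF b \<epsilon> x p] by linarith
      qed
      then have "norm (F (w \<epsilon> x) - F (w' \<epsilon> x))
          \<le> (DIM('b) * (A * (1 + norm (norm (w \<epsilon> x) + norm (w' \<epsilon> x))) ^ n)) * norm (w \<epsilon> x - w' \<epsilon> x)"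
        using S[OF \<epsilon>] x K(2) by (intro norm_diff_le_partials[OF _ F(1)]) auto
      moreover have "A \<ge> 0" unfolding A_def by (rule sum_nonneg) auto
      ultimately show ?thesis
        by (cases "w \<epsilon> x = w' \<epsilon> x") (auto simp: h_def divide_le_eq mult.assoc intro!: mult_nonneg_nonneg)
    qed
    moreover have "A \<ge> 0" unfolding A_def by (rule sum_nonneg) auto
    ultimately show "\<exists>C\<ge>0. \<exists>k. \<forall>\<epsilon>\<in>{0<..1}. \<forall>x\<in>K.
        norm (h \<epsilon> x) \<le> C * (1 + norm (norm (w \<epsilon> x) + norm (w' \<epsilon> x))) ^ k"
      by (intro exI[of _ "DIM('b) * A"] exI[of _ n] conjI ballI) auto
  qed
  then show ?thesis
    by (rule negligibly_bounded_dominated[OF _ neg]) (auto simp: h_def)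
qed

lemma moderate_graph:
  fixes a :: "real \<Rightarrow> 'a::euclidean_space \<Rightarrow> 'b::euclidean_space"
  assumes "open \<Omega>" "a \<in> moderate \<Omega>"
  shows "(\<lambda>\<epsilon> x. (x, a \<epsilon> x)) \<in> moderate \<Omega>"
proof -
  have "(\<lambda>\<epsilon> x. (x, 0 :: 'b)) \<in> moderate \<Omega>"
    by (rule moderate_linear[OF assms(1) bounded_linear_Pair[OF bounded_linear_ident bounded_linear_zero]
          moderate_ident[OF assms(1)]])
  moreover have "(\<lambda>\<epsilon> x. (0 :: 'a, a \<epsilon> x)) \<in> moderate \<Omega>"
    by (rule moderate_linear[OF assms(1) bounded_linear_Pair[OF bounded_linear_zero bounded_linear_ident]
          assms(2)])
  ultimately have "(\<lambda>\<epsilon> x. (x, 0) + (0, a \<epsilon> x)) \<in> moderate \<Omega>"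
    by (rule moderate_add[OF assms(1)])
  then show ?thesis by simp
qed

text \<open>
  The growth condition in the second variable weakened to a bound in terms of the whole point, which is
  what composition with the net \<open>\<lambda>\<epsilon> x. (x, a \<epsilon> x)\<close> uses.
\<close>

lemma slowly_increasing_snd_on_graph_bound:
  assumes "slowly_increasing_snd_on S F" "compact K" "K \<subseteq> fst ` S" "set vs \<subseteq> Basis"
  shows "\<exists>C (m::nat). \<forall>x a. (x, a) \<in> S \<longrightarrow> x \<in> K \<longrightarrow>
       norm (iter_partial vs F (x, a)) \<le> C * (1 + norm (x, a)) ^ m"
proof -
  obtain C and m :: nat where *:
      "\<forall>(x, w)\<in>S. x \<in> K \<longrightarrow> norm (iter_partial vs F (x, w)) \<le> C * (1 + norm w) ^ m"
    using assms unfolding slowly_increasing_snd_on_def by blast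
  have "norm (iter_partial vs F (x, a)) \<le> \<bar>C\<bar> * (1 + norm (x, a)) ^ m" if "(x, a) \<in> S" "x \<in> K" for x a
  proof -
    have "norm (iter_partial vs F (x, a)) \<le> C * (1 + norm a) ^ m"
      using * that by auto
    also have "\<dots> \<le> \<bar>C\<bar> * (1 + norm a) ^ m"
      by (intro mult_right_mono) auto
    also have "\<dots> \<le> \<bar>C\<bar> * (1 + norm (x, a)) ^ m"
      using norm_snd_le[of a x] by (intro mult_left_mono power_mono) auto
    finally show ?thesis .
  qed
  then show ?thesis by (intro exI[of _ "\<bar>C\<bar>"] exI[of _ m]) auto
qed

lemma moderate_slowly_increasing:
  assumes "open \<Omega>" "a \<in> moderate \<Omega>" "slowly_increasing_snd_on S F"
    and S: "\<And>\<epsilon> x. \<epsilon> \<in> {0<..1} \<Longrightarrow> x \<in> \<Omega> \<Longrightarrow> (x, a \<epsilon> x) \<in> S"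
  shows "(\<lambda>\<epsilon> x. F (x, a \<epsilon> x)) \<in> moderate \<Omega>"
proof (rule moderate_compose[OF assms(1) moderate_graph[OF assms(1,2)]])
  show "moderate_along \<Omega> (\<lambda>\<epsilon> x. (x, a \<epsilon> x)) (\<lambda>_. F)"
  proof (rule moderate_along_polynomial[OF moderate_graph[OF assms(1,2)] S])
    show "smooth_on S F" using assms(3) by (simp add: slowly_increasing_snd_on_def)
    fix K and vs :: "('a \<times> 'b) list" assume K: "compact K" "K \<subseteq> \<Omega>" and vs: "set vs \<subseteq> Basis"
    have "K \<subseteq> fst ` S"
      using S[of 1] K(2) by (force simp: image_iff)
    then obtain C and m :: nat where "\<forall>x a. (x, a) \<in> S \<longrightarrow> x \<in> K \<longrightarrow>
        norm (iter_partial vs F (x, a)) \<le> C * (1 + norm (x, a)) ^ m"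
      using slowly_increasing_snd_on_graph_bound[OF assms(3) K(1) _ vs] by blast
    then show "\<exists>C (m::nat). \<forall>\<epsilon>\<in>{0<..1}. \<forall>x\<in>K.
        norm (iter_partial vs F (x, a \<epsilon> x)) \<le> C * (1 + norm (x, a \<epsilon> x)) ^ m"
      using S K(2) by (intro exI[of _ C] exI[of _ m] ballI) (auto simp: subset_iff)
  qed
qed

lemma negligible_slowly_increasing_diff:
  fixes a a' :: "real \<Rightarrow> 'a::euclidean_space \<Rightarrow> 'b::euclidean_space"
  assumes "open \<Omega>" "a \<in> moderate \<Omega>" "a' \<in> moderate \<Omega>" "slowly_increasing_snd_on S F"
    and S: "\<Omega> \<times> UNIV \<subseteq> S"
    and neg: "negligibly_bounded \<Omega> (\<lambda>\<epsilon> x. a \<epsilon> x - a' \<epsilon> x)"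
  shows "negligibly_bounded \<Omega> (\<lambda>\<epsilon> x. F (x, a \<epsilon> x) - F (x, a' \<epsilon> x))"
proof (rule negligibly_bounded_diff_compose)
  show "moderately_bounded \<Omega> (\<lambda>\<epsilon> x. (x, a \<epsilon> x))" "moderately_bounded \<Omega> (\<lambda>\<epsilon> x. (x, a' \<epsilon> x))"
    by (intro moderate_moderately_bounded moderate_graph assms)+
  show "negligibly_bounded \<Omega> (\<lambda>\<epsilon> x. (x, a \<epsilon> x) - (x, a' \<epsilon> x))"
    using neg by (simp add: negligibly_bounded_def norm_Pair)
  have seg: "closed_segment (x, y) (x, z) \<subseteq> {x} \<times> UNIV" for x :: 'a and y z :: 'b
    by (auto simp: closed_segment_def algebra_simps simp flip: scaleR_add_left)
  show "closed_segment (x, a \<epsilon> x) (x, a' \<epsilon> x) \<subseteq> S" if "x \<in> \<Omega>" for \<epsilon> x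
    using seg[of x "a \<epsilon> x" "a' \<epsilon> x"] S that by blast
  show "smooth_on S F" using assms(4) by (simp add: slowly_increasing_snd_on_def)
  fix K and b :: "'a \<times> 'b" assume K: "compact K" "K \<subseteq> \<Omega>" and b: "b \<in> Basis"
  have "K \<subseteq> fst ` S"
    using S K(2) by (force simp: image_iff)
  moreover have "set [b] \<subseteq> Basis" using b by simp
  ultimately obtain C and m :: nat where C: "\<forall>x a. (x, a) \<in> S \<longrightarrow> x \<in> K \<longrightarrow>
      norm (iter_partial [b] F (x, a)) \<le> C * (1 + norm (x, a)) ^ m"
    using slowly_increasing_snd_on_graph_bound[OF assms(4) K(1), of "[b]"] by blast
  have "norm (frechet_derivative F (at p) b) \<le> C * (1 + norm p) ^ m"
    if x: "x \<in> K" and p: "p \<in> closed_segment (x, a \<epsilon> x) (x, a' \<epsilon> x)" for \<epsilon> x p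
  proof -
    obtain y where "p = (x, y)"
      using seg[of x "a \<epsilon> x" "a' \<epsilon> x"] p by auto
    then show ?thesis using C[rule_format, of x y] x K(2) S by auto
  qed
  then show "\<exists>C (m::nat). \<forall>\<epsilon>\<in>{0<..1}. \<forall>x\<in>K. \<forall>p\<in>closed_segment (x, a \<epsilon> x) (x, a' \<epsilon> x).
      norm (frechet_derivative F (at p) b) \<le> C * (1 + norm p) ^ m"
    by (intro exI[of _ C] exI[of _ m] ballI)
qed

text \<open>
  For \<open>x\<close> in a ball of radius \<open>R\<close> one has \<open>1 + norm (x, w) \<le> (1 + R) * (1 + norm w)\<close>.
\<close>

lemma slowly_increasing_imp_snd:
  fixes F :: "'a::euclidean_space \<times> 'b::euclidean_space \<Rightarrow> 'c::real_normed_vector"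
  assumes "slowly_increasing_on S F"
  shows "slowly_increasing_snd_on S F"
  unfolding slowly_increasing_snd_on_def
proof (intro conjI allI impI; (elim conjE)?)
  show "smooth_on S F" using assms by (simp add: slowly_increasing_on_def)
  fix K :: "'a set" and vs :: "('a \<times> 'b) list" assume K: "compact K" and vs: "set vs \<subseteq> Basis"
  obtain C and m :: nat where C: "\<And>z. z \<in> S \<Longrightarrow> norm (iter_partial vs F z) \<le> C * (1 + norm z) ^ m"
    using assms vs unfolding slowly_increasing_on_def by blast
  obtain R where R: "R > 0" "\<And>x. x \<in> K \<Longrightarrow> norm x \<le> R"
    using compact_imp_bounded[OF K] bounded_pos by metis
  have "norm (iter_partial vs F (x, w)) \<le> (\<bar>C\<bar> * (1 + R) ^ m) * (1 + norm w) ^ m"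
    if "(x, w) \<in> S" "x \<in> K" for x w
  proof -
    have "norm (iter_partial vs F (x, w)) \<le> C * (1 + norm (x, w)) ^ m" by (rule C[OF that(1)])
    also have "\<dots> \<le> \<bar>C\<bar> * (1 + norm (x, w)) ^ m" by (intro mult_right_mono) auto
    also have "\<dots> \<le> \<bar>C\<bar> * ((1 + R) * (1 + norm w)) ^ m"
    proof (intro mult_left_mono power_mono)
      have "norm (x, w) \<le> norm x + norm w" by (rule norm_Pair_le)
      then show "1 + norm (x, w) \<le> (1 + R) * (1 + norm w)"
        using R(2)[OF that(2)] mult_nonneg_nonneg[OF less_imp_le[OF R(1)] norm_ge_zero[of w]]
        by (simp add: distrib_left distrib_right)
    qed auto
    finally show ?thesis by (simp add: power_mult_distrib mult_ac)
  qed
  then show "\<exists>C (m::nat). \<forall>(x, w)\<in>S. x \<in> K \<longrightarrow>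
      norm (iter_partial vs F (x, w)) \<le> C * (1 + norm w) ^ m"
    by (intro exI[of _ "\<bar>C\<bar> * (1 + R) ^ m"] exI[of _ m]) auto
qed

section \<open>Jets of nets\<close>

text \<open>
  The choice of the list depends on the multi-index alone, so the same order of differentiation serves
  all functions; in particular a component of the jet is additive on smooth functions.
\<close>

lemma multi_partial_eq_iter_partial:
  obtains vs :: "(real^'p::finite) list" where "set vs \<subseteq> Basis"
    "\<And>f :: real^'p \<Rightarrow> 'b::real_normed_vector. multi_partial \<alpha> f = iter_partial vs f"
proof
  show "set (map (\<lambda>i. axis i (1::real)) (SOME is. \<forall>i. count_list is i = \<alpha> i)) \<subseteq> Basis"
    by (auto simp: axis_in_Basis_iff)
qed (simp add: multi_partial_def)

text \<open>
  The fibre component \<open>u\<^sup>(\<^sup>n\<^sup>)\<close>, split off because growth conditions and differences concern it alone.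
\<close>

definition jet_part ::
    "(real^'p \<Rightarrow> real^'q) \<Rightarrow> real^'p \<Rightarrow> ((real^'q), ('p::finite, 'n::len0) multi_index) vec" where
  "jet_part u x = (\<chi> J. multi_partial (exponents J) u x)"

lemma jet_eq: "jet u x = (x, jet_part u x)"
  by (simp add: jet_def jet_part_def)

text \<open>
  The components of the jet are iterated partial derivatives, and these are moderate by definition; the
  jet is assembled from them by linear maps.
\<close>

lemma moderate_jet_part:
  fixes u :: "real \<Rightarrow> real^'p \<Rightarrow> real^'q"
  assumes "open \<Omega>" "u \<in> moderate \<Omega>"
  shows "(\<lambda>\<epsilon>. jet_part (u \<epsilon>) :: _ \<Rightarrow> ((real^'q), ('p::finite, 'n::len0) multi_index) vec) \<in> moderate \<Omega>"
proof -
  have "(\<lambda>\<epsilon> x. axis J (multi_partial (exponents J) (u \<epsilon>) x)) \<in> moderate \<Omega>"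
    for J :: "('p, 'n) multi_index"
  proof -
    have "linear (axis J :: real^'q \<Rightarrow> (real^'q)^('p, 'n) multi_index)"
      by (rule linearI) (auto simp: axis_def vec_eq_iff)
    then have axis: "bounded_linear (axis J :: real^'q \<Rightarrow> (real^'q)^('p, 'n) multi_index)"
      by (simp add: linear_conv_bounded_linear)
    obtain vs :: "(real^'p) list" where vs: "set vs \<subseteq> Basis"
      "\<And>f :: real^'p \<Rightarrow> real^'q. multi_partial (exponents J) f = iter_partial vs f"
      using multi_partial_eq_iter_partial[of "exponents J"] by blast
    then have "(\<lambda>\<epsilon>. multi_partial (exponents J) (u \<epsilon>)) \<in> moderate \<Omega>"
      using moderate_iter_partial[OF assms(2) vs(1)] by simp
    then show ?thesis by (rule moderate_linear[OF assms(1) axis])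
  qed
  then have "(\<lambda>\<epsilon> x. \<Sum>J\<in>(UNIV :: ('p, 'n) multi_index set).
      axis J (multi_partial (exponents J) (u \<epsilon>) x)) \<in> moderate \<Omega>"
    by (rule moderate_sum[OF assms(1)])
  moreover have "(\<Sum>J\<in>UNIV. axis J (w J)) = (\<chi> J. w J)" for w :: "('p, 'n) multi_index \<Rightarrow> real^'q"
    by (simp add: vec_eq_iff axis_def)
  ultimately show ?thesis by (simp add: jet_part_def[abs_def])
qed

lemma negligible_jet_part_diff:
  fixes u v :: "real \<Rightarrow> real^'p \<Rightarrow> real^'q"
  assumes "open \<Omega>" "u \<in> moderate \<Omega>" "v \<in> moderate \<Omega>"
    and "(\<lambda>\<epsilon> x. u \<epsilon> x - v \<epsilon> x) \<in> negligible_nets \<Omega>"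
  shows "negligibly_bounded \<Omega> (\<lambda>\<epsilon> x. jet_part (u \<epsilon>) x -
    (jet_part (v \<epsilon>) x :: ((real^'q), ('p::finite, 'n::len0) multi_index) vec))"
proof (rule negligibly_bounded_vec)
  fix J :: "('p, 'n) multi_index"
  obtain vs :: "(real^'p) list" where vs: "set vs \<subseteq> Basis"
    "\<And>f :: real^'p \<Rightarrow> real^'q. multi_partial (exponents J) f = iter_partial vs f"
    using multi_partial_eq_iter_partial[of "exponents J"] by blast
  have "negligibly_bounded \<Omega> (\<lambda>\<epsilon>. iter_partial vs (\<lambda>x. u \<epsilon> x - v \<epsilon> x))"
    using negligibly_bounded_iter_partial[OF assms(1) _ _ vs(1)] assms(4) negligible_nets_iff[OF assms(1)]
    by blast
  then show "negligibly_bounded \<Omega> (\<lambda>\<epsilon> x. (jet_part (u \<epsilon>) x -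
      (jet_part (v \<epsilon>) x :: ((real^'q), ('p, 'n) multi_index) vec)) $ J)"
    using negligibly_bounded_cong[of \<Omega> "\<lambda>\<epsilon>. iter_partial vs (\<lambda>x. u \<epsilon> x - v \<epsilon> x)"
        "\<lambda>\<epsilon> x. iter_partial vs (u \<epsilon>) x - iter_partial vs (v \<epsilon>) x"]
      iter_partial_diff[OF assms(1) moderate_imp_smooth[OF assms(2)] moderate_imp_smooth[OF assms(3)] _ vs(1)]
    by (simp add: jet_part_def vs(2))
qed

lemma times_subset_jet_space: "\<Omega> \<times> UNIV \<subseteq> M \<Longrightarrow> \<Omega> \<times> UNIV \<subseteq> jet_space M"
  by (auto simp: jet_space_def)

lemma moderate_eval:
  fixes \<Delta> :: "('p::finite, 'q::finite, 'n::len0) jet \<Rightarrow> real^'l::finite"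
  assumes "open \<Omega>" "\<Omega> \<times> UNIV \<subseteq> M" "slowly_increasing_on (jet_space M) \<Delta>" "u \<in> moderate \<Omega>"
  shows "(\<lambda>\<epsilon> x. \<Delta> (jet (u \<epsilon>) x)) \<in> moderate \<Omega>"
  unfolding jet_eq
  by (rule moderate_slowly_increasing[OF assms(1) moderate_jet_part[OF assms(1,4)]
        slowly_increasing_imp_snd[OF assms(3)]])
    (use times_subset_jet_space[OF assms(2)] in auto)

text \<open>
  The class \<open>\<Delta>(x, pr\<^sup>(\<^sup>n\<^sup>)U)\<close> is computed on any representative, because jets of negligible differences
  are negligible and \<open>\<Delta>\<close> is slowly increasing.
\<close>

lemma colombeau_eval_cl:
  fixes \<Delta> :: "('p::finite, 'q::finite, 'n::len0) jet \<Rightarrow> real^'l::finite"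
  assumes "open \<Omega>" "\<Omega> \<times> UNIV \<subseteq> M" "slowly_increasing_on (jet_space M) \<Delta>" "u \<in> moderate \<Omega>"
  shows "colombeau_eval \<Delta> \<Omega> (cl \<Omega> u) = cl \<Omega> (\<lambda>\<epsilon> x. \<Delta> (jet (u \<epsilon>) x))"
  unfolding colombeau_eval_def
proof (rule UN_cl_eq[OF assms(1,1,4), where T = "\<lambda>u \<epsilon> x. \<Delta> (jet (u \<epsilon>) x)"])
  fix u v :: "real \<Rightarrow> real^'p \<Rightarrow> real^'q"
  assume u: "u \<in> moderate \<Omega>"
  then show "(\<lambda>\<epsilon> x. \<Delta> (jet (u \<epsilon>) x)) \<in> moderate \<Omega>"
    by (rule moderate_eval[OF assms(1-3)])
  assume v: "v \<in> moderate \<Omega>" and uv: "(\<lambda>\<epsilon> x. u \<epsilon> x - v \<epsilon> x) \<in> negligible_nets \<Omega>"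
  show "negligibly_bounded \<Omega> (\<lambda>\<epsilon> x. \<Delta> (jet (u \<epsilon>) x) - \<Delta> (jet (v \<epsilon>) x))"
    unfolding jet_eq
    by (rule negligible_slowly_increasing_diff[OF assms(1) moderate_jet_part[OF assms(1) u]
          moderate_jet_part[OF assms(1) v] slowly_increasing_imp_snd[OF assms(3)]
          times_subset_jet_space[OF assms(2)] negligible_jet_part_diff[OF assms(1) u v uv]])
qed

section \<open>Projectable transformation groups\<close>

text \<open>
  The base component of the group law \<open>g\<^sub>-\<^sub>\<eta> g\<^sub>\<eta> z = z\<close>.
\<close>

lemma projectable_group_inverse:
  assumes "local_one_parameter_group r M D g" "projectable_with D g \<Xi> \<Phi>" "(\<eta>, x, u) \<in> D"
  shows "(- \<eta>, \<Xi> \<eta> x, \<Phi> \<eta> (x, u)) \<in> D" "\<Xi> (- \<eta>) (\<Xi> \<eta> x) = x"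
proof -
  have g: "g \<eta> (x, u) = (\<Xi> \<eta> x, \<Phi> \<eta> (x, u))"
    using assms(2,3) by (auto simp: projectable_with_def)
  have inv: "(- \<eta>, g \<eta> (x, u)) \<in> D" "g (- \<eta>) (g \<eta> (x, u)) = (x, u)"
    using assms(1,3) unfolding local_one_parameter_group_def by auto
  show "(- \<eta>, \<Xi> \<eta> x, \<Phi> \<eta> (x, u)) \<in> D" using inv(1) by (simp add: g)
  then show "\<Xi> (- \<eta>) (\<Xi> \<eta> x) = x"
    using inv(2) assms(2) unfolding g projectable_with_def by fastforce
qed

text \<open>
  Since \<open>D\<close> is open, the inverse \<open>\<Xi> (- \<eta>)\<close> makes sense and is smooth near every point of the image.
  Nearby points that it maps into \<open>\<Omega>\<close> are images themselves, and by continuity these form a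
  neighbourhood.
\<close>

lemma projected_inverse_smooth:
  fixes g :: "real \<Rightarrow> 'a::euclidean_space \<times> 'b::euclidean_space \<Rightarrow> 'a \<times> 'b"
  assumes G: "local_one_parameter_group r M D g" and P: "projectable_with D g \<Xi> \<Phi>"
    and \<Omega>: "open \<Omega>" "{\<eta>} \<times> \<Omega> \<times> UNIV \<subseteq> D"
  shows "open (\<Xi> \<eta> ` \<Omega>)" "smooth_on (\<Xi> \<eta> ` \<Omega>) (\<Xi> (- \<eta>))"
proof -
  have nbhd: "\<exists>N. open N \<and> y \<in> N \<and> N \<subseteq> \<Xi> \<eta> ` \<Omega> \<and> smooth_on N (\<Xi> (- \<eta>))"
    if y: "y \<in> \<Xi> \<eta> ` \<Omega>" for y
  proof -
    obtain x where x: "x \<in> \<Omega>" "y = \<Xi> \<eta> x" using y by blast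
    \<comment> \<open>With the fibre coordinate frozen at \<open>w\<close>, the base component of \<open>g\<close> is \<open>\<Xi> (- \<eta>)\<close>, so the smoothness
      of \<open>g\<close> on its open domain gives that of \<open>\<Xi> (- \<eta>)\<close> near \<open>y\<close>.\<close>
    define w where "w = \<Phi> \<eta> (x, 0)"
    have xD: "(\<eta>, x, 0) \<in> D" using \<Omega>(2) x(1) by auto
    have D: "open D" and smooth: "smooth_on D (\<lambda>(\<eta>, z). g \<eta> z)"
      using G by (auto simp: local_one_parameter_group_def)
    define N where "N = (\<lambda>y. (- \<eta>, y, w)) -` D"
    have N: "open N" unfolding N_def by (rule open_vimage[OF D]) (intro continuous_intros)
    have yN: "y \<in> N"
      using projectable_group_inverse(1)[OF G P xD] by (simp add: N_def w_def x(2))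
    have proj: "fst (g (- \<eta>) (y', w)) = \<Xi> (- \<eta>) y'" if "y' \<in> N" for y'
      using that P by (auto simp: N_def projectable_with_def)
    have "(\<lambda>_ y. (- \<eta>, 0 :: 'a, w) + (0, y, 0)) \<in> moderate N"
      by (intro moderate_add[OF N] moderate_const[OF N]
          moderate_linear[OF N bounded_linear_Pair[OF bounded_linear_zero
            bounded_linear_Pair[OF bounded_linear_ident bounded_linear_zero]] moderate_ident[OF N]])
    then have "smooth_on N (\<lambda>y. (- \<eta>, y, w))"
      using moderate_imp_smooth[of _ N 1] by fastforce
    then have "smooth_on N (\<lambda>y. (\<lambda>(\<eta>, z). g \<eta> z) (- \<eta>, y, w))"
      by (rule smooth_on_compose[OF N _ smooth]) (auto simp: N_def)
    from moderate_imp_smooth[OF moderate_linear[OF N bounded_linear_fst moderate_of_smooth[OF N this]], of 1]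
    have "smooth_on N (\<lambda>y. fst (g (- \<eta>) (y, w)))" by simp
    then have sm: "smooth_on N (\<Xi> (- \<eta>))" by (rule smooth_on_cong_open[OF N]) (rule proj)
    then have "continuous_on N (\<Xi> (- \<eta>))"
      by (rule smooth_on_imp_continuous_on)
    then have "open (\<Xi> (- \<eta>) -` \<Omega> \<inter> N)"
      using continuous_on_open_vimage[OF N] \<Omega>(1) by blast
    moreover have "y \<in> \<Xi> (- \<eta>) -` \<Omega> \<inter> N"
      using projectable_group_inverse(2)[OF G P xD] x yN by simp
    \<comment> \<open>A neighbour \<open>y'\<close> of \<open>y\<close> is the image of \<open>\<Xi> (- \<eta>) y'\<close>: apply the inversion formula to \<open>- \<eta>\<close>.\<close>
    moreover have "\<Xi> (- \<eta>) -` \<Omega> \<inter> N \<subseteq> \<Xi> \<eta> ` \<Omega>"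
    proof
      fix y' assume y': "y' \<in> \<Xi> (- \<eta>) -` \<Omega> \<inter> N"
      then have "(- \<eta>, y', w) \<in> D" by (simp add: N_def)
      from projectable_group_inverse(2)[OF G P this] have "y' = \<Xi> \<eta> (\<Xi> (- \<eta>) y')" by simp
      then show "y' \<in> \<Xi> \<eta> ` \<Omega>" using y' by blast
    qed
    moreover have "smooth_on (\<Xi> (- \<eta>) -` \<Omega> \<inter> N) (\<Xi> (- \<eta>))"
      using sm by (auto simp: smooth_on_def)
    ultimately show ?thesis by blast
  qed
  show "open (\<Xi> \<eta> ` \<Omega>)"
    using nbhd by (subst open_subopen) meson
  show "smooth_on (\<Xi> \<eta> ` \<Omega>) (\<Xi> (- \<eta>))"
    unfolding smooth_on_def
  proof (intro allI impI ballI)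
    fix vs :: "'a list" and y assume vs: "set vs \<subseteq> Basis" and y: "y \<in> \<Xi> \<eta> ` \<Omega>"
    obtain N where "y \<in> N" "smooth_on N (\<Xi> (- \<eta>))" using nbhd[OF y] by blast
    then show "iter_partial vs (\<Xi> (- \<eta>)) differentiable at y"
      using vs by (simp add: smooth_on_def)
  qed
qed

text \<open>
  One transformation \<open>g\<^sub>\<eta>\<close> acting on functions and nets on a fixed open set \<open>\<Omega>\<close> whose cylinder lies in the
  domain of the group.
\<close>

locale projectable_action =
  fixes r :: ereal and M :: "('a::euclidean_space \<times> 'b::euclidean_space) set"
    and D :: "(real \<times> 'a \<times> 'b) set"
    and g :: "real \<Rightarrow> 'a \<times> 'b \<Rightarrow> 'a \<times> 'b"
    and \<Xi> :: "real \<Rightarrow> 'a \<Rightarrow> 'a" and \<Phi> :: "real \<Rightarrow> 'a \<times> 'b \<Rightarrow> 'b"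
    and \<eta> :: real and \<Omega> :: "'a set"
  assumes group: "local_one_parameter_group r M D g"
    and slow: "slowly_increasing_group D g \<Xi> \<Phi>"
    and open_\<Omega>: "open \<Omega>"
    and defined: "colombeau_act_defined M D \<Xi> \<eta> \<Omega>"

begin

lemma projectable: "projectable_with D g \<Xi> \<Phi>"
  using slow by (simp add: slowly_increasing_group_def)

lemma cylinder: "{\<eta>} \<times> \<Omega> \<times> UNIV \<subseteq> D"
  using defined by (simp add: colombeau_act_defined_def)

lemma open_image: "open (\<Xi> \<eta> ` \<Omega>)"
  and smooth_inverse: "smooth_on (\<Xi> \<eta> ` \<Omega>) (\<Xi> (- \<eta>))"
  using projected_inverse_smooth[OF group projectable open_\<Omega> cylinder] by auto

lemma inverse_image [simp]: "x \<in> \<Omega> \<Longrightarrow> \<Xi> (- \<eta>) (\<Xi> \<eta> x) = x"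
  using projectable_group_inverse(2)[OF group projectable] cylinder by blast

lemma inverse_into: "\<Xi> (- \<eta>) ` \<Xi> \<eta> ` \<Omega> \<subseteq> \<Omega>"
  by auto

lemma continuous_inverse: "continuous_on (\<Xi> \<eta> ` \<Omega>) (\<Xi> (- \<eta>))"
  by (rule smooth_on_imp_continuous_on[OF smooth_inverse])

lemma inv_into_eq: "y \<in> \<Xi> \<eta> ` \<Omega> \<Longrightarrow> inv_into \<Omega> (\<Xi> \<eta>) y = \<Xi> (- \<eta>) y"
  using inv_into_f_f[OF inj_on_inverseI[where g = "\<Xi> (- \<eta>)"]] by auto

definition act :: "('a \<Rightarrow> 'b) \<Rightarrow> 'a \<Rightarrow> 'b" where
  "act u = (\<lambda>x. \<Phi> \<eta> (x, u x)) \<circ> inv_into \<Omega> (\<Xi> \<eta>)"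

lemma act_eq: "y \<in> \<Xi> \<eta> ` \<Omega> \<Longrightarrow> act u y = \<Phi> \<eta> (\<Xi> (- \<eta>) y, u (\<Xi> (- \<eta>) y))"
  by (simp add: act_def inv_into_eq)

lemma slow_\<Phi>: "slowly_increasing_snd_on {z. (\<eta>, z) \<in> D} (\<Phi> \<eta>)"
  using slow by (simp add: slowly_increasing_group_def)

lemma moderate_pullback:
  "u \<in> moderate \<Omega> \<Longrightarrow> (\<lambda>\<epsilon> y. u \<epsilon> (\<Xi> (- \<eta>) y)) \<in> moderate (\<Xi> \<eta> ` \<Omega>)"
  by (rule moderate_compose_smooth[OF open_image smooth_inverse inverse_into])

text \<open>
  Compose with the slowly increasing \<open>\<Phi> \<eta>\<close> on \<open>\<Omega>\<close>, then pull back along \<open>\<Xi> (- \<eta>)\<close>.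
\<close>

lemma moderate_act:
  assumes "u \<in> moderate \<Omega>"
  shows "(\<lambda>\<epsilon>. act (u \<epsilon>)) \<in> moderate (\<Xi> \<eta> ` \<Omega>)"
proof (rule moderate_cong[OF open_image])
  have "(\<lambda>\<epsilon> x. \<Phi> \<eta> (x, u \<epsilon> x)) \<in> moderate \<Omega>"
    by (rule moderate_slowly_increasing[OF open_\<Omega> assms slow_\<Phi>]) (use cylinder in auto)
  then show "(\<lambda>\<epsilon> y. \<Phi> \<eta> (\<Xi> (- \<eta>) y, u \<epsilon> (\<Xi> (- \<eta>) y))) \<in> moderate (\<Xi> \<eta> ` \<Omega>)"
    by (rule moderate_pullback)
qed (simp add: act_eq)

text \<open>
  Representatives that differ by a negligible net are transformed into such representatives: the
  difference of the values of \<open>\<Phi> \<eta>\<close> is estimated by the mean value theorem along the fibre, which is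
  a whole vector space and hence convex.
\<close>

lemma colombeau_act_cl:
  assumes "u \<in> moderate \<Omega>"
  shows "colombeau_act (\<Xi> \<eta>) (\<Phi> \<eta>) \<Omega> (cl \<Omega> u) = cl (\<Xi> \<eta> ` \<Omega>) (\<lambda>\<epsilon>. act (u \<epsilon>))"
  unfolding colombeau_act_def act_def[symmetric]
proof (rule UN_cl_eq[OF open_\<Omega> open_image assms, where T = "\<lambda>u \<epsilon>. act (u \<epsilon>)"])
  fix u v :: "real \<Rightarrow> 'a \<Rightarrow> 'b"
  assume u: "u \<in> moderate \<Omega>"
  then show "(\<lambda>\<epsilon>. act (u \<epsilon>)) \<in> moderate (\<Xi> \<eta> ` \<Omega>)" by (rule moderate_act)
  assume v: "v \<in> moderate \<Omega>" and uv: "(\<lambda>\<epsilon> x. u \<epsilon> x - v \<epsilon> x) \<in> negligible_nets \<Omega>"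
  have "negligibly_bounded \<Omega> (\<lambda>\<epsilon> x. \<Phi> \<eta> (x, u \<epsilon> x) - \<Phi> \<eta> (x, v \<epsilon> x))"
    by (rule negligible_slowly_increasing_diff[OF open_\<Omega> u v slow_\<Phi>])
      (use cylinder uv negligible_nets_iff[OF open_\<Omega>] in auto)
  from negligibly_bounded_compose[OF this continuous_inverse inverse_into]
  show "negligibly_bounded (\<Xi> \<eta> ` \<Omega>) (\<lambda>\<epsilon> y. act (u \<epsilon>) y - act (v \<epsilon>) y)"
    by (subst negligibly_bounded_cong[where h = "\<lambda>\<epsilon> y. \<Phi> \<eta> (\<Xi> (- \<eta>) y, u \<epsilon> (\<Xi> (- \<eta>) y))
        - \<Phi> \<eta> (\<Xi> (- \<eta>) y, v \<epsilon> (\<Xi> (- \<eta>) y))"]) (simp_all add: act_eq)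
qed

text \<open>
  The transformed representative is the transformed function in the geometric sense of graphs.  This is
  what makes the factorization, an assertion on smooth functions, applicable for each fixed \<open>\<epsilon>\<close>.
\<close>

lemma transforms_to_act: "transforms_to D g \<eta> \<Omega> u (\<Xi> \<eta> ` \<Omega>) (act u)"
proof -
  have "g \<eta> (x, u x) = (\<Xi> \<eta> x, act u (\<Xi> \<eta> x))" if "x \<in> \<Omega>" for x
  proof -
    have "(\<eta>, x, u x) \<in> D" using cylinder that by blast
    then show ?thesis
      using projectable that by (auto simp: projectable_with_def act_eq)
  qed
  then have "g \<eta> ` graph_on \<Omega> u = graph_on (\<Xi> \<eta> ` \<Omega>) (act u)"
    unfolding graph_on_def image_image by (intro image_cong) auto
  then show ?thesis
    using cylinder open_image by (auto simp: transforms_to_def graph_on_def)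
qed

end

section \<open>Symmetry groups in the Colombeau algebra\<close>

text \<open>
  For each \<open>\<epsilon>\<close> the factorization expresses \<open>\<Delta>\<close> on the transformed representative as a sum of products of a
  coefficient, moderate by assumption, and a component of \<open>\<Delta>\<close> on the original representative, which is
  negligible because \<open>U\<close> is a solution.
\<close>

lemma moderate_coefficients_imp_symmetry:
  fixes \<Delta> :: "('p::finite, 'q::finite, 'n::len0) jet \<Rightarrow> real^'l::finite"
  assumes \<Delta>: "slowly_increasing_on (jet_space M) \<Delta>"
    and G: "local_one_parameter_group r M D g" "slowly_increasing_group D g \<Xi> \<Phi>"
    and fact: "factorizes_with \<Delta> D g \<Xi> V Q"
    and Q: "moderate_coefficients M D \<Xi> Q"
  shows "colombeau_symmetry_group M \<Delta> D \<Xi> \<Phi>"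
  unfolding colombeau_symmetry_group_def
proof (intro allI impI; elim conjE)
  fix \<eta> \<Omega> U
  assume U: "colombeau_solution M \<Delta> \<Omega> U" and def: "colombeau_act_defined M D \<Xi> \<eta> \<Omega>"
  have \<Omega>: "open \<Omega>" "\<Omega> \<times> UNIV \<subseteq> M" "U \<in> colombeau \<Omega>" "colombeau_eval \<Delta> \<Omega> U = cl \<Omega> (\<lambda>_ _. 0)"
    using U by (auto simp: colombeau_solution_def)
  interpret projectable_action r M D g \<Xi> \<Phi> \<eta> \<Omega>
    by unfold_locales (fact G \<Omega>(1) def)+
  have M': "(\<Xi> \<eta> ` \<Omega>) \<times> UNIV \<subseteq> M" using def by (simp add: colombeau_act_defined_def)
  obtain u where u: "u \<in> moderate \<Omega>" "U = cl \<Omega> u"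
    using \<Omega>(3) unfolding colombeau_def cl_def by (elim quotientE)
  have zero: "negligibly_bounded \<Omega> (\<lambda>\<epsilon> x. \<Delta> (jet (u \<epsilon>) x))"
    using \<Omega>(4) cl_eq_zero_iff[OF \<Omega>(1) moderate_eval[OF \<Omega>(1,2) \<Delta> u(1)]]
    unfolding u(2) colombeau_eval_cl[OF \<Omega>(1,2) \<Delta> u(1)] by blast
  have "negligibly_bounded (\<Xi> \<eta> ` \<Omega>) (\<lambda>\<epsilon> y. \<Delta> (jet (act (u \<epsilon>)) y))"
  proof (rule negligibly_bounded_vec)
    fix \<nu>
    have "negligibly_bounded (\<Xi> \<eta> ` \<Omega>) (\<lambda>\<epsilon> y. \<Sum>\<mu>\<in>UNIV.
        Q \<mu> \<nu> \<eta> (jet (u \<epsilon>) (\<Xi> (- \<eta>) y)) * \<Delta> (jet (u \<epsilon>) (\<Xi> (- \<eta>) y)) $ \<mu>)"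
    proof (rule negligibly_bounded_sum)
      fix \<mu>
      have "(\<lambda>\<epsilon> y. Q \<mu> \<nu> \<eta> (jet (u \<epsilon>) (\<Xi> (- \<eta>) y))) \<in> moderate (\<Xi> \<eta> ` \<Omega>)"
        using Q \<Omega>(1) def u(1) unfolding moderate_coefficients_def by blast
      note * = negligibly_bounded_dominated[OF moderate_moderately_bounded[OF this]
          negligibly_bounded_compose[OF zero continuous_inverse inverse_into]]
      show "negligibly_bounded (\<Xi> \<eta> ` \<Omega>) (\<lambda>\<epsilon> y.
          Q \<mu> \<nu> \<eta> (jet (u \<epsilon>) (\<Xi> (- \<eta>) y)) * \<Delta> (jet (u \<epsilon>) (\<Xi> (- \<eta>) y)) $ \<mu>)"
        by (rule *) (simp add: abs_mult mult_left_mono component_le_norm_cart)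
    qed simp
    moreover have "\<Delta> (jet (act (u \<epsilon>)) y) $ \<nu> = (\<Sum>\<mu>\<in>UNIV.
        Q \<mu> \<nu> \<eta> (jet (u \<epsilon>) (\<Xi> (- \<eta>) y)) * \<Delta> (jet (u \<epsilon>) (\<Xi> (- \<eta>) y)) $ \<mu>)"
      if \<epsilon>: "\<epsilon> \<in> {0<..1}" and y: "y \<in> \<Xi> \<eta> ` \<Omega>" for \<epsilon> y
    proof -
      obtain x where x: "x \<in> \<Omega>" "y = \<Xi> \<eta> x" using y by blast
      then show ?thesis
        using fact[unfolded factorizes_with_def, rule_format,
            OF conjI[OF \<Omega>(1) conjI[OF moderate_imp_smooth[OF u(1) \<epsilon>] transforms_to_act]] x(1)]
        by simp
    qed
    ultimately show "negligibly_bounded (\<Xi> \<eta> ` \<Omega>) (\<lambda>\<epsilon> y. \<Delta> (jet (act (u \<epsilon>)) y) $ \<nu>)"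
      by (subst negligibly_bounded_cong) auto
  qed
  then have "cl (\<Xi> \<eta> ` \<Omega>) (\<lambda>\<epsilon> y. \<Delta> (jet (act (u \<epsilon>)) y)) = cl (\<Xi> \<eta> ` \<Omega>) (\<lambda>_ _. 0)"
    using cl_eq_zero_iff[OF open_image moderate_eval[OF open_image M' \<Delta> moderate_act[OF u(1)]]] by blast
  then show "colombeau_solution M \<Delta> (\<Xi> \<eta> ` \<Omega>) (colombeau_act (\<Xi> \<eta>) (\<Phi> \<eta>) \<Omega> U)"
    unfolding colombeau_solution_def u(2) colombeau_act_cl[OF u(1)]
      colombeau_eval_cl[OF open_image M' \<Delta> moderate_act[OF u(1)]]
    using open_image M' quotientI[OF moderate_act[OF u(1)]] by (auto simp: colombeau_def cl_def)
qed

text \<open>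
  The coefficient nets are compositions of a slowly increasing function with the moderate net of jets,
  pulled back along \<open>\<Xi> (- \<eta>)\<close>.  That the jets stay in \<open>V\<close>, where the growth of \<open>Q\<close> is controlled, is part
  of the factorization.
\<close>

lemma slowly_increasing_imp_moderate_coefficients:
  fixes \<Delta> :: "('p::finite, 'q::finite, 'n::len0) jet \<Rightarrow> real^'l::finite"
  assumes G: "local_one_parameter_group r M D g" "slowly_increasing_group D g \<Xi> \<Phi>"
    and fact: "factorizes_with \<Delta> D g \<Xi> V Q"
    and Q: "\<And>\<mu> \<nu> \<eta>. ereal \<bar>\<eta>\<bar> < r \<Longrightarrow> slowly_increasing_snd_on V (Q \<mu> \<nu> \<eta>)"
  shows "moderate_coefficients M D \<Xi> Q"
  unfolding moderate_coefficients_def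
proof (intro allI impI ballI; elim conjE)
  fix \<eta> \<Omega> \<mu> \<nu> and u :: "real \<Rightarrow> real^'p \<Rightarrow> real^'q"
  assume \<Omega>: "open \<Omega>" and def: "colombeau_act_defined M D \<Xi> \<eta> \<Omega>" and u: "u \<in> moderate \<Omega>"
  interpret projectable_action r M D g \<Xi> \<Phi> \<eta> \<Omega>
    by unfold_locales (fact G \<Omega> def)+
  show "(\<lambda>\<epsilon> y. Q \<mu> \<nu> \<eta> (jet (u \<epsilon>) (\<Xi> (- \<eta>) y))) \<in> moderate (\<Xi> \<eta> ` \<Omega>)"
  proof (cases "\<Omega> = {}")
    \<comment> \<open>An empty \<open>\<Omega>\<close> puts no restriction on \<open>\<eta>\<close>, but on the empty set every net is moderate.\<close>
    case True
    then show ?thesis by (simp add: moderate_def smooth_on_def)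
  next
    case False
    then obtain x where "x \<in> \<Omega>" by blast
    then have "ereal \<bar>\<eta>\<bar> < r"
      using cylinder G(1) unfolding local_one_parameter_group_def by blast
    have "jet (u \<epsilon>) x \<in> V" if "\<epsilon> \<in> {0<..1}" "x \<in> \<Omega>" for \<epsilon> x
      using fact[unfolded factorizes_with_def, rule_format,
          OF conjI[OF \<Omega> conjI[OF moderate_imp_smooth[OF u that(1)] transforms_to_act]] that(2)]
      by blast
    then have "(\<lambda>\<epsilon> x. Q \<mu> \<nu> \<eta> (jet (u \<epsilon>) x)) \<in> moderate \<Omega>"
      unfolding jet_eq
      by (intro moderate_slowly_increasing[OF \<Omega> moderate_jet_part[OF \<Omega> u] Q[OF \<open>ereal \<bar>\<eta>\<bar> < r\<close>]])
    then show ?thesis by (rule moderate_pullback)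
  qed
qed

theorem proposition3p5:
  fixes M :: "((real^'p) \<times> (real^'q)) set"
    and \<Delta> :: "('p::finite, 'q::finite, 'n::len0) jet \<Rightarrow> real^'l::finite"
    and \<eta>\<^sub>o :: ereal
    and D :: "(real \<times> (real^'p) \<times> (real^'q)) set"
    and g :: "real \<Rightarrow> (real^'p) \<times> (real^'q) \<Rightarrow> (real^'p) \<times> (real^'q)"
    and \<Xi> :: "real \<Rightarrow> real^'p \<Rightarrow> real^'p"
    and \<Phi> :: "real \<Rightarrow> (real^'p) \<times> (real^'q) \<Rightarrow> real^'q"
    and V :: "('p, 'q, 'n) jet set"
    and Q :: "'l \<Rightarrow> 'l \<Rightarrow> real \<Rightarrow> ('p, 'q, 'n) jet \<Rightarrow> real"
  assumes "open M"
    and "slowly_increasing_on (jet_space M) \<Delta>"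
    and "nondegenerate M \<Delta>"
    and "0 < \<eta>\<^sub>o"
    and "local_one_parameter_group \<eta>\<^sub>o M D g"
    and "slowly_increasing_group D g \<Xi> \<Phi>"
    and "classical_symmetry_group M \<Delta> D g"
    and "open V" and "V \<subseteq> jet_space M"
    and "\<And>\<mu> \<nu>. smooth_on ({\<eta>. ereal \<bar>\<eta>\<bar> < \<eta>\<^sub>o} \<times> V) (\<lambda>(\<eta>, z). Q \<mu> \<nu> \<eta> z)"
    and "factorizes_with \<Delta> D g \<Xi> V Q"
  shows "(moderate_coefficients M D \<Xi> Q \<longrightarrow> colombeau_symmetry_group M \<Delta> D \<Xi> \<Phi>) \<and>
         ((\<forall>\<mu> \<nu> \<eta>. ereal \<bar>\<eta>\<bar> < \<eta>\<^sub>o \<longrightarrow> slowly_increasing_snd_on V (Q \<mu> \<nu> \<eta>)) \<longrightarrow>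
            moderate_coefficients M D \<Xi> Q)"
  using moderate_coefficients_imp_symmetry[OF assms(2,5,6,11)]
    slowly_increasing_imp_moderate_coefficients[OF assms(5,6,11)]
  by blast

end
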